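(* Let $\varphi(x_1,\ldots,x_n)$ be a term in the language $\mathcal{L}_\lambda=\{+,-,\cdot,0,1\}\cup\{\lambda^k,\sigma^k,\psi_k\}_{k\ge 1}$, and let $(d_1,\ldots,d_n)=\operatorname{depth}(\varphi)$. Then there exists a unique polynomial $$P_\varphi^\lambda\in\mathbb{Z}[x_{1,1},\ldots,x_{1,d_1},\ldots,x_{n,1},\ldots,x_{n,d_n}]$$ such that for every model $(R,\lambda,\sigma,\psi)$ of $\mathcal{T}$ and all $r_1,\ldots,r_n\in R$, $$\varphi(r_1,\ldots,r_n)=P_\varphi^\lambda\bigl(\lambda^1(r_1),\ldots,\lambda^{d_1}(r_1),\ldots,\lambda^1(r_n),\ldots,\lambda^{d_n}(r_n)\bigr).$$ Moreover, for torsion free rings (i.e. regarding $\varphi$ as an expression in models of $\mathcal{T}$ whose additive group is torsion free), the Simplification Algorithm described in the context, applied to $\varphi$, outputs the polynomial $P_\varphi^\lambda$.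
   Context: All rings are commutative with unit. **$\lambda$-rings.** A $\lambda$-ring structure on a ring $R$ is a family of maps $\lambda^i:R\to R$, $i\ge 0$ (not necessarily homomorphisms), with $\lambda^0(x)=1$, $\lambda^1(x)=x$ and $\lambda^n(x+y)=\sum_{i=0}^n\lambda^i(x)\lambda^{n-i}(y)$ for all $x,y\in R$, $n\ge 0$. Put $\lambda_t(x)=\sum_{i\ge 0}\lambda^i(x)t^i$. The opposite $\lambda$-ring structure $\sigma$ is defined by $\sigma_t(x)=\sum_{i\ge 0}\sigma^i(x)t^i=(\lambda_{-t}(x))^{-1}$; the opposite of $\sigma$ is $\lambda$. **Special.** Let $e_k$ denote elementary symmetric polynomials. Let $P_n$ and $P_{n,m}$ be the universal integral polynomials determined by $$P_n\bigl(e_1(X),\ldots,e_n(X),e_1(Y),\ldots,e_n(Y)\bigr)=\operatorname{coeff}_{t^n}\prod_{i,j=1}^n(1+tX_iY_j)$$ (with $X=(X_1,\ldots,X_n)$, $Y=(Y_1,\ldots,Y_n)$) and $$P_{n,m}\bigl(e_1(X),\ldots,e_{nm}(X)\bigr)=\operatorname{coeff}_{t^n}\prod_{1\le j_1<\cdots<j_m\le nm}\Bigl(1+t\prod_{k=1}^mX_{j_k}\Bigr)$$ (with $X=(X_1,\ldots,X_{nm})$). A $\lambda$-ring structure $\tau$ is special if $\tau^n(1)=0$ for $n\ge 2$, $\tau^n(xy)=P_n(\tau^1(x),\ldots,\tau^n(x),\tau^1(y),\ldots,\tau^n(y))$ and $\tau^n(\tau^m(x))=P_{n,m}(\tau^1(x),\ldots,\tau^{nm}(x))$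 for all $x,y\in R$ and $n,m\ge 1$. **Adams operations.** Let $N_n\in\mathbb{Z}[s_1,\ldots,s_n]$ be the polynomial with $\sum_{i=1}^mX_i^n=N_n(e_1(X_1,\ldots,X_m),\ldots,e_n(X_1,\ldots,X_m))$ for all $m$. The Adams operations of $\sigma$ are $\psi_n(x)=N_n(\sigma^1(x),\ldots,\sigma^n(x))$, $n\ge 1$. **The theory $\mathcal{T}$.** A model of $\mathcal{T}$ is a commutative unital ring $R$ with a $\lambda$-ring structure $\lambda$ whose opposite structure $\sigma$ is special, together with the Adams operations $\psi$ of $\sigma$. The function symbols $\lambda^k,\sigma^k,\psi_k$ of $\mathcal{L}_\lambda$ are interpreted accordingly. **Depth.** For a term $\varphi$ in variables $x_1,\ldots,x_n$, $\operatorname{depth}(\varphi)\in\mathbb{Z}_{\ge0}^n$ is defined recursively: $\operatorname{depth}(0)=\operatorname{depth}(1)=(0,\ldots,0)$; $\operatorname{depth}(x_i)$ is the $i$-th unit vector; $\operatorname{depth}(-\varphi)=\operatorname{depth}(\varphi)$; $\operatorname{depth}(\varphi+\xi)=\operatorname{depth}(\varphi\cdot\xi)$ is the componentwise maximum of $\operatorname{depth}(\varphi)$ and $\operatorname{depth}(\xi)$; $\operatorname{depth}(\lambda^k(\varphi))=\operatorname{depth}(\sigma^k(\varphi))=\operatorname{depth}(\psi_k(\varphi))=k\operatorname{depth}(\varphi)$ for $k\ge1$. **Auxiliary polynomials.** Define $P^{op}_0=1$, $P^{op}_n=\sum_{i=0}^{n-1}(-1)^{n-i+1}P^{op}_i\,x_{n-i}$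 for $n\ge1$; $L_1=x_1$, $L_n=\frac1n\bigl((-1)^{n-1}x_n+\sum_{i=1}^{n-1}(-1)^{i-1}L_{n-i}x_i\bigr)$ for $n>1$; $L^{op}_n=P^{op}_n(L_1,\ldots,L_n)\in\mathbb{Q}[x_1,\ldots,x_n]$; $N^{op}_n=N_n(P^{op}_1,\ldots,P^{op}_n)\in\mathbb{Z}[x_1,\ldots,x_n]$. **Simplification Algorithm.** Input: a term $\varphi(x_1,\ldots,x_n)$ with $\operatorname{depth}(\varphi)=(d_1,\ldots,d_n)$. (1) For each $i$ and $1\le k\le d_i$ compute $\Psi_{i,k}=N^{op}_k(x_{i,1},\ldots,x_{i,k})$. (2) For each $i$ and $a,b\ge1$ with $ab\le d_i$ compute $\mu_{a,b}(x_i)=L^{op}_b(\Psi_{i,a},\Psi_{i,2a},\ldots,\Psi_{i,ba})$. (3) For a polynomial $\omega$ in the variables $x_{i,j}$, let $\mathrm{ApplyPsi}(\omega,k)$ be the result of simultaneously substituting $\mu_{k,j}(x_i)$ for $x_{i,j}$ in $\omega$, for all $i,j$. (4) Evaluate $\varphi$ from the innermost subterms outwards: $0,1$ and the ring operations are evaluated as in the polynomial ring; a bare variable $x_i$ becomes $x_{i,1}$; $\lambda^k(x_i)$ becomes $x_{i,k}$; if a subterm $\omega$ has already been evaluated to a polynomial (again denoted $\omega$), then $\psi_k(\omega)$ becomes $\mathrm{ApplyPsi}(\omega,k)$, $\sigma^k(\omega)$ becomes $L_k(\mathrm{ApplyPsi}(\omega,1),\ldots,\mathrm{ApplyPsi}(\omega,k))$,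 and $\lambda^k(\omega)$ (when $\omega$ is not a bare variable) becomes $L^{op}_k(\mathrm{ApplyPsi}(\omega,1),\ldots,\mathrm{ApplyPsi}(\omega,k))$. (5) Output the expanded resulting polynomial (a priori with rational coefficients). *)

theory Defs
  imports
    "HOL-Library.Poly_Mapping"
    "HOL-Computational_Algebra.Polynomial"
    "HOL-Algebra.Ring"
begin

section \<open>Multivariate polynomials\<close>

text \<open>
  A polynomial with variables of type \<open>'v\<close> and coefficients in \<open>'c\<close> is a finitely supported
  map from monomials (themselves finitely supported exponent vectors) to \<open>'c\<close>; the ring structure
  is the convolution product of the library theory Poly_Mapping.
\<close>

type_synonym ('v, 'c) mpoly = "('v \<Rightarrow>\<^sub>0 nat) \<Rightarrow>\<^sub>0 'c"

definition mvar :: "'v \<Rightarrow> ('v, 'c::comm_ring_1) mpoly" where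
  "mvar v = Poly_Mapping.single (Poly_Mapping.single v 1) 1"

definition mconst :: "'c \<Rightarrow> ('v, 'c::comm_ring_1) mpoly" where
  "mconst c = Poly_Mapping.single 0 c"

definition polys_in :: "'v set \<Rightarrow> ('v, 'c::comm_ring_1) mpoly set" where
  "polys_in V = {p. \<forall>m \<in> Poly_Mapping.keys p. Poly_Mapping.keys m \<subseteq> V}"

definition msubst :: "('v \<Rightarrow> ('w, 'c) mpoly) \<Rightarrow> ('v, 'c::comm_ring_1) mpoly \<Rightarrow> ('w, 'c) mpoly" where
  "msubst f p = (\<Sum>m \<in> Poly_Mapping.keys p.
     mconst (Poly_Mapping.lookup p m) *
     (\<Prod>v \<in> Poly_Mapping.keys m. f v ^ Poly_Mapping.lookup m v))"

definition to_rat :: "('v, int) mpoly \<Rightarrow> ('v, rat) mpoly" where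
  "to_rat p = Poly_Mapping.map of_int p"

definition meval :: "('a, 'b) ring_scheme \<Rightarrow> ('v \<Rightarrow> 'a) \<Rightarrow> ('v, int) mpoly \<Rightarrow> 'a" where
  "meval R f p = (\<Oplus>\<^bsub>R\<^esub> m \<in> Poly_Mapping.keys p.
     [Poly_Mapping.lookup p m] \<cdot>\<^bsub>R\<^esub>
     (\<Otimes>\<^bsub>R\<^esub> v \<in> Poly_Mapping.keys m. f v [^]\<^bsub>R\<^esub> Poly_Mapping.lookup m v))"

definition esym :: "'v set \<Rightarrow> nat \<Rightarrow> ('v, int) mpoly" where
  "esym V k = (\<Sum>S | S \<subseteq> V \<and> card S = k. \<Prod>v \<in> S. mvar v)"


section \<open>The universal polynomials\<close>

text \<open>
  In each definite description the ring to which the polynomial belongs is part of the condition.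
  For \<open>P_poly\<close> the variables \<open>Inl i\<close> and \<open>Inr i\<close> form the two
  blocks of \<open>n\<close> variables, both for the argument polynomial and for the \<open>X\<^sub>i\<close>, \<open>Y\<^sub>j\<close>;
  the products are univariate polynomials in \<open>t\<close> over the ring of multivariate polynomials.
\<close>

definition P_poly :: "nat \<Rightarrow> (nat + nat, int) mpoly" where
  "P_poly n = (THE P. P \<in> polys_in (Inl ` {1..n} \<union> Inr ` {1..n}) \<and>
     msubst (case_sum (esym (Inl ` {1..n})) (esym (Inr ` {1..n}))) P =
     Polynomial.coeff
       (\<Prod>i\<in>{1..n}. \<Prod>j\<in>{1..n}. [:1, mvar (Inl i) * mvar (Inr j):] ::
         (nat + nat, int) mpoly poly) n)"

definition P_comp_poly :: "nat \<Rightarrow> nat \<Rightarrow> (nat, int) mpoly" where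
  "P_comp_poly n m = (THE P. P \<in> polys_in {1..n * m} \<and>
     msubst (esym {1..n * m}) P =
     Polynomial.coeff
       (\<Prod>S | S \<subseteq> {1..n * m} \<and> card S = m. [:1, \<Prod>j\<in>S. mvar j:] :: (nat, int) mpoly poly) n)"

definition N_poly :: "nat \<Rightarrow> (nat, int) mpoly" where
  "N_poly n = (THE N. N \<in> polys_in {1..n} \<and>
     (\<forall>m::nat. msubst (esym {1..m}) N = (\<Sum>i\<in>{1..m}. mvar i ^ n)))"


section \<open>Lambda-rings\<close>

text \<open>A power series over \<open>R\<close> is its coefficient sequence.\<close>

definition ps_mult ::
    "('a, 'b) ring_scheme \<Rightarrow> (nat \<Rightarrow> 'a) \<Rightarrow> (nat \<Rightarrow> 'a) \<Rightarrow> (nat \<Rightarrow> 'a)" where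
  "ps_mult R f g = (\<lambda>n. \<Oplus>\<^bsub>R\<^esub> i \<in> {..n}. f i \<otimes>\<^bsub>R\<^esub> g (n - i))"

definition ps_one :: "('a, 'b) ring_scheme \<Rightarrow> nat \<Rightarrow> 'a" where
  "ps_one R = (\<lambda>n. if n = 0 then \<one>\<^bsub>R\<^esub> else \<zero>\<^bsub>R\<^esub>)"

locale lambda_ring = cring R for R :: "('a, 'b) ring_scheme" (structure) +
  fixes lam :: "nat \<Rightarrow> 'a \<Rightarrow> 'a"
  assumes lam_closed: "x \<in> carrier R \<Longrightarrow> lam i x \<in> carrier R"
    and lam_0: "x \<in> carrier R \<Longrightarrow> lam 0 x = \<one>"
    and lam_1: "x \<in> carrier R \<Longrightarrow> lam 1 x = x"
    and lam_add: "\<lbrakk>x \<in> carrier R; y \<in> carrier R\<rbrakk> \<Longrightarrow>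
          lam n (x \<oplus> y) = (\<Oplus>i\<in>{0..n}. lam i x \<otimes> lam (n - i) y)"

locale special_lambda_ring = lambda_ring R tau
  for R :: "('a, 'b) ring_scheme" (structure) and tau +
  assumes tau_one: "n \<ge> 2 \<Longrightarrow> tau n \<one> = \<zero>"
    and tau_mult: "\<lbrakk>x \<in> carrier R; y \<in> carrier R; n \<ge> 1\<rbrakk> \<Longrightarrow>
          tau n (x \<otimes> y) = meval R (case_sum (\<lambda>i. tau i x) (\<lambda>i. tau i y)) (P_poly n)"
    and tau_comp: "\<lbrakk>x \<in> carrier R; n \<ge> 1; m \<ge> 1\<rbrakk> \<Longrightarrow>
          tau n (tau m x) = meval R (\<lambda>i. tau i x) (P_comp_poly n m)"

text \<open>
  \<open>sig_inverse\<close> states that \<open>\<sigma>\<^sub>t(x)\<close> is the inverse power series of \<open>\<lambda>\<^bsub>-t\<^esub>(x)\<close>.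
  All maps are constrained on the carrier only.
\<close>

locale lambda_model = lambda_ring R lam + special_lambda_ring R sig
  for R :: "('a, 'b) ring_scheme" (structure) and lam and sig +
  fixes psi :: "nat \<Rightarrow> 'a \<Rightarrow> 'a"
  assumes sig_inverse: "x \<in> carrier R \<Longrightarrow>
          ps_mult R (\<lambda>i. sig i x) (\<lambda>i. (\<ominus> \<one>) [^] i \<otimes> lam i x) = ps_one R"
    and psi_eq: "\<lbrakk>x \<in> carrier R; k \<ge> 1\<rbrakk> \<Longrightarrow>
          psi k x = meval R (\<lambda>i. sig i x) (N_poly k)"


section \<open>Terms\<close>

datatype lterm =
    Zero
  | One
  | Var nat
  | Neg lterm
  | Add lterm lterm
  | Mul lterm lterm
  | Lam nat lterm
  | Sig nat lterm
  | Psi nat lterm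

text \<open>
  \<open>is_term n \<phi>\<close>: the variables of \<open>\<phi>\<close> are among \<open>x\<^sub>1, \<dots>, x\<^sub>n\<close>, and all operation indices
  are at least 1, as the language has no symbols with index 0.
\<close>

primrec is_term :: "nat \<Rightarrow> lterm \<Rightarrow> bool" where
  "is_term n Zero \<longleftrightarrow> True"
| "is_term n One \<longleftrightarrow> True"
| "is_term n (Var i) \<longleftrightarrow> 1 \<le> i \<and> i \<le> n"
| "is_term n (Neg s) \<longleftrightarrow> is_term n s"
| "is_term n (Add s t) \<longleftrightarrow> is_term n s \<and> is_term n t"
| "is_term n (Mul s t) \<longleftrightarrow> is_term n s \<and> is_term n t"
| "is_term n (Lam k s) \<longleftrightarrow> 1 \<le> k \<and> is_term n s"
| "is_term n (Sig k s) \<longleftrightarrow> 1 \<le> k \<and> is_term n s"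
| "is_term n (Psi k s) \<longleftrightarrow> 1 \<le> k \<and> is_term n s"

primrec depth :: "lterm \<Rightarrow> nat \<Rightarrow> nat" where
  "depth Zero = (\<lambda>i. 0)"
| "depth One = (\<lambda>i. 0)"
| "depth (Var j) = (\<lambda>i. if i = j then 1 else 0)"
| "depth (Neg s) = depth s"
| "depth (Add s t) = (\<lambda>i. max (depth s i) (depth t i))"
| "depth (Mul s t) = (\<lambda>i. max (depth s i) (depth t i))"
| "depth (Lam k s) = (\<lambda>i. k * depth s i)"
| "depth (Sig k s) = (\<lambda>i. k * depth s i)"
| "depth (Psi k s) = (\<lambda>i. k * depth s i)"

primrec interp :: "('a, 'b) ring_scheme \<Rightarrow> (nat \<Rightarrow> 'a \<Rightarrow> 'a) \<Rightarrow> (nat \<Rightarrow> 'a \<Rightarrow> 'a) \<Rightarrow>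
    (nat \<Rightarrow> 'a \<Rightarrow> 'a) \<Rightarrow> (nat \<Rightarrow> 'a) \<Rightarrow> lterm \<Rightarrow> 'a" where
  "interp R lam sig psi r Zero = \<zero>\<^bsub>R\<^esub>"
| "interp R lam sig psi r One = \<one>\<^bsub>R\<^esub>"
| "interp R lam sig psi r (Var i) = r i"
| "interp R lam sig psi r (Neg s) = \<ominus>\<^bsub>R\<^esub> interp R lam sig psi r s"
| "interp R lam sig psi r (Add s t) = interp R lam sig psi r s \<oplus>\<^bsub>R\<^esub> interp R lam sig psi r t"
| "interp R lam sig psi r (Mul s t) = interp R lam sig psi r s \<otimes>\<^bsub>R\<^esub> interp R lam sig psi r t"
| "interp R lam sig psi r (Lam k s) = lam k (interp R lam sig psi r s)"
| "interp R lam sig psi r (Sig k s) = sig k (interp R lam sig psi r s)"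
| "interp R lam sig psi r (Psi k s) = psi k (interp R lam sig psi r s)"

text \<open>The pair \<open>(i, j)\<close> is the variable \<open>x\<^bsub>i,j\<^esub>\<close>, standing for \<open>\<lambda>\<^sup>j(x\<^sub>i)\<close>.\<close>

definition depth_vars :: "nat \<Rightarrow> lterm \<Rightarrow> (nat \<times> nat) set" where
  "depth_vars n \<phi> = {(i, j). 1 \<le> i \<and> i \<le> n \<and> 1 \<le> j \<and> j \<le> depth \<phi> i}"

text \<open>
  A formula cannot quantify over all types, so the type argument is the universe containing the
  carriers of the models.  The quantification over all models is recovered by leaving \<open>'a\<close>
  schematic in a theorem.  For uniqueness the universe has to be fixed; models with
  carrier in \<open>nat\<close>, i.e. the countable ones up to isomorphism, make it as strong as
  uniqueness over any larger class.
\<close>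

definition represents :: "'a itself \<Rightarrow> nat \<Rightarrow> lterm \<Rightarrow> (nat \<times> nat, int) mpoly \<Rightarrow> bool" where
  "represents (U :: 'a itself) n \<phi> P \<longleftrightarrow>
     (\<forall>(R :: 'a ring) lam sig psi. lambda_model R lam sig psi \<longrightarrow>
       (\<forall>r. (\<forall>i\<in>{1..n}. r i \<in> carrier R) \<longrightarrow>
         interp R lam sig psi r \<phi> = meval R (\<lambda>(i, j). lam j (r i)) P))"


section \<open>The Simplification Algorithm\<close>

fun Pop_poly :: "nat \<Rightarrow> (nat, int) mpoly" where
  "Pop_poly n = (if n = 0 then 1
     else (\<Sum>i<n. (-1) ^ (n - i + 1) * Pop_poly i * mvar (n - i)))"

text \<open>The index 0 is not used for \<open>L_poly\<close>; its value there is arbitrary.\<close>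

fun L_poly :: "nat \<Rightarrow> (nat, rat) mpoly" where
  "L_poly n = (if n = 0 then 1 else if n = 1 then mvar 1
     else mconst (1 / of_nat n) *
       ((-1) ^ (n - 1) * mvar n + (\<Sum>i\<in>{1..<n}. (-1) ^ (i - 1) * L_poly (n - i) * mvar i)))"

declare Pop_poly.simps [simp del] L_poly.simps [simp del]

definition Lop_poly :: "nat \<Rightarrow> (nat, rat) mpoly" where
  "Lop_poly n = msubst L_poly (to_rat (Pop_poly n))"

definition Nop_poly :: "nat \<Rightarrow> (nat, int) mpoly" where
  "Nop_poly n = msubst Pop_poly (N_poly n)"

definition Psi_poly :: "nat \<Rightarrow> nat \<Rightarrow> (nat \<times> nat, rat) mpoly" where
  "Psi_poly i k = msubst (\<lambda>j. mvar (i, j)) (to_rat (Nop_poly k))"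

definition mu_poly :: "nat \<Rightarrow> nat \<Rightarrow> nat \<Rightarrow> (nat \<times> nat, rat) mpoly" where
  "mu_poly a b i = msubst (\<lambda>j. Psi_poly i (j * a)) (Lop_poly b)"

definition ApplyPsi :: "(nat \<times> nat, rat) mpoly \<Rightarrow> nat \<Rightarrow> (nat \<times> nat, rat) mpoly" where
  "ApplyPsi \<omega> k = msubst (\<lambda>(i, j). mu_poly k j i) \<omega>"

text \<open>
  The polynomials \<open>\<Psi>\<^bsub>i,k\<^esub>\<close> and \<open>\<mu>\<^bsub>a,b\<^esub>(x\<^sub>i)\<close> are unfolded where they are used instead of being
  tabulated in advance up to the depth of the input term.
\<close>

primrec simplification :: "lterm \<Rightarrow> (nat \<times> nat, rat) mpoly" where
  "simplification Zero = 0"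
| "simplification One = 1"
| "simplification (Var i) = mvar (i, 1)"
| "simplification (Neg s) = - simplification s"
| "simplification (Add s t) = simplification s + simplification t"
| "simplification (Mul s t) = simplification s * simplification t"
| "simplification (Lam k s) =
     (case s of
        Var i \<Rightarrow> mvar (i, k)
      | _ \<Rightarrow> msubst (ApplyPsi (simplification s)) (Lop_poly k))"
| "simplification (Sig k s) = msubst (ApplyPsi (simplification s)) (L_poly k)"
| "simplification (Psi k s) = ApplyPsi (simplification s) k"

end

theory Submission
  imports Defs "HOL-Computational_Algebra.Polynomial_FPS" "HOL-Library.Countable_Set"
begin

text \<open>
  Existence of an integral polynomial is a structural induction on the term: the axioms of a special
  \<open>\<lambda>\<close>-ring express \<open>\<sigma>\<^sup>k\<close> of a sum, a product, a negative or some \<open>\<sigma>\<^sup>j(x\<^sub>i)\<close> by polynomials with integer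
  coefficients.  For uniqueness and for the correctness of the algorithm it suffices to exhibit one
  countable model in which the \<open>\<lambda>\<^sup>j(x\<^sub>i)\<close> are algebraically independent and evaluation of terms is the
  algorithm itself: the ring of rational polynomials in the \<open>x\<^bsub>i,j\<^esub>\<close>, with the commuting ring
  endomorphisms \<open>\<psi>\<^sub>k = ApplyPsi(\<cdot>, k)\<close> and \<open>\<sigma>\<^sup>k = L\<^sub>k(\<psi>\<^sub>1, \<dots>, \<psi>\<^sub>k)\<close>.

  That this \<open>\<sigma>\<close> is special follows from formulas for \<open>P\<^sub>n\<close> and \<open>P\<^bsub>n,m\<^esub>\<close> in terms of power sums, e.g.
  \<open>P\<^sub>n = L\<^sub>n(N\<^sub>1(x) N\<^sub>1(y), \<dots>, N\<^sub>n(x) N\<^sub>n(y))\<close>, which a priori only define rational polynomials.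
  Their integrality, and the uniqueness of the universal polynomials, come from Kronecker's
  substitution: sending the variables to suitable powers of one variable \<open>t\<close> turns the elementary
  symmetric polynomials into monic polynomials such that distinct monomials in them have distinct
  degrees in \<open>t\<close>.
\<close>


section \<open>Evaluation of polynomials\<close>

definition is_ring_hom :: "('a::comm_ring_1 \<Rightarrow> 'b::comm_ring_1) \<Rightarrow> bool" where
  "is_ring_hom h \<longleftrightarrow> h 1 = 1 \<and> (\<forall>a b. h (a + b) = h a + h b) \<and> (\<forall>a b. h (a * b) = h a * h b)"

context
  fixes h :: "'a::comm_ring_1 \<Rightarrow> 'b::comm_ring_1"
  assumes h: "is_ring_hom h"
begin

lemma hom_1: "h 1 = 1" and hom_add: "h (a + b) = h a + h b" and hom_mult: "h (a * b) = h a * h b"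
  using h by (auto simp: is_ring_hom_def)

lemma hom_0: "h 0 = 0"
  using hom_add[of 0 0] by simp

lemma hom_uminus: "h (- a) = - h a"
  using hom_add[of a "- a"] hom_0 by (simp add: eq_neg_iff_add_eq_0 add.commute)

lemma hom_diff: "h (a - b) = h a - h b"
  using hom_add[of a "- b"] hom_uminus[of b] by simp

lemma hom_sum: "h (sum f A) = (\<Sum>x\<in>A. h (f x))"
  by (induction A rule: infinite_finite_induct) (auto simp: hom_0 hom_add)

lemma hom_prod: "h (prod f A) = (\<Prod>x\<in>A. h (f x))"
  by (induction A rule: infinite_finite_induct) (auto simp: hom_1 hom_mult)

lemma hom_power: "h (a ^ n) = h a ^ n"
  by (induction n) (auto simp: hom_1 hom_mult)

lemma hom_of_nat: "h (of_nat n) = of_nat n"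
  by (induction n) (auto simp: hom_1 hom_add hom_0)

lemma hom_of_int: "h (of_int n) = of_int n"
  by (cases n rule: int_diff_cases) (simp add: hom_diff hom_of_nat)

lemmas hom_simps = hom_0 hom_1 hom_add hom_mult hom_uminus hom_diff hom_sum hom_prod hom_power
  hom_of_nat hom_of_int

end

lemma is_ring_hom_id: "is_ring_hom (\<lambda>x. x)"
  by (simp add: is_ring_hom_def)

lemma is_ring_hom_of_int: "is_ring_hom of_int"
  by (simp add: is_ring_hom_def)

lemma is_ring_hom_comp:
  "is_ring_hom g \<Longrightarrow> is_ring_hom h \<Longrightarrow> is_ring_hom (\<lambda>x. g (h x))"
  by (simp add: is_ring_hom_def)

section \<open>Evaluation along a coefficient map\<close>

definition mono_eval :: "('v \<Rightarrow> 'r) \<Rightarrow> ('v \<Rightarrow>\<^sub>0 nat) \<Rightarrow> 'r::comm_ring_1" where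
  "mono_eval f m = (\<Prod>v\<in>Poly_Mapping.keys m. f v ^ Poly_Mapping.lookup m v)"

lemma mono_eval_superset:
  assumes "finite S" "Poly_Mapping.keys m \<subseteq> S"
  shows "mono_eval f m = (\<Prod>v\<in>S. f v ^ Poly_Mapping.lookup m v)"
  unfolding mono_eval_def
  by (rule prod.mono_neutral_left) (use assms in \<open>auto simp: in_keys_iff\<close>)

lemma mono_eval_0 [simp]: "mono_eval f 0 = 1"
  by (simp add: mono_eval_def)

lemma mono_eval_single [simp]: "mono_eval f (Poly_Mapping.single v k) = f v ^ k"
  by (simp add: mono_eval_def)

lemma mono_eval_add: "mono_eval f (m + m') = mono_eval f m * mono_eval f m'"
proof -
  let ?S = "Poly_Mapping.keys m \<union> Poly_Mapping.keys m'"
  have "mono_eval f (m + m') = (\<Prod>v\<in>?S. f v ^ Poly_Mapping.lookup (m + m') v)"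
    using keys_add[of m m'] by (intro mono_eval_superset) auto
  also have "\<dots> = mono_eval f m * mono_eval f m'"
    by (simp add: mono_eval_superset[of ?S] lookup_add power_add prod.distrib)
  finally show ?thesis .
qed

text \<open>The coefficient map \<open>h\<close> lets one notion cover several:
  \<open>h = mconst\<close> gives \<open>msubst\<close>, integers sent to rational constants give
  \<open>to_rat\<close>, and \<open>[:c:]\<close> gives the Kronecker substitution.\<close>

definition peval :: "('c \<Rightarrow> 'r) \<Rightarrow> ('v \<Rightarrow> 'r) \<Rightarrow> ('v, 'c::comm_ring_1) mpoly \<Rightarrow> 'r::comm_ring_1" where
  "peval h f p = (\<Sum>m\<in>Poly_Mapping.keys p. h (Poly_Mapping.lookup p m) * mono_eval f m)"

lemma poly_mapping_sum_singles:
  "p = (\<Sum>m\<in>Poly_Mapping.keys p. Poly_Mapping.single m (Poly_Mapping.lookup p m))"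
proof (rule poly_mapping_eqI)
  fix k
  have "(\<Sum>m\<in>Poly_Mapping.keys p. Poly_Mapping.lookup p m when m = k) = Poly_Mapping.lookup p k"
    by (auto simp: when_def in_keys_iff)
  then show "Poly_Mapping.lookup p k = Poly_Mapping.lookup
      (\<Sum>m\<in>Poly_Mapping.keys p. Poly_Mapping.single m (Poly_Mapping.lookup p m)) k"
    by (simp add: lookup_sum lookup_single)
qed

text \<open>Restricting the monomials to \<open>M\<close> makes the induction usable for polynomials
  in a prescribed set of variables.\<close>

lemma poly_mapping_single_induct:
  fixes p :: "'m \<Rightarrow>\<^sub>0 'c::comm_ring_1"
  assumes "P 0" "\<And>m c. m \<in> M \<Longrightarrow> P (Poly_Mapping.single m c)"
    and "\<And>p q. P p \<Longrightarrow> P q \<Longrightarrow> P (p + q)" and "Poly_Mapping.keys p \<subseteq> M"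
  shows "P p"
proof -
  have "P (\<Sum>m\<in>A. Poly_Mapping.single m (Poly_Mapping.lookup p m))"
    if "finite A" "A \<subseteq> M" for A
    using that by (induction A) (auto intro!: assms)
  then have "P (\<Sum>m\<in>Poly_Mapping.keys p. Poly_Mapping.single m (Poly_Mapping.lookup p m))"
    using assms(4) by auto
  then show ?thesis by (simp flip: poly_mapping_sum_singles)
qed

lemma mconst_0 [simp]: "mconst 0 = 0" and mconst_1 [simp]: "mconst 1 = 1"
  by (simp_all add: mconst_def)

lemma is_ring_hom_mconst: "is_ring_hom mconst"
  by (simp add: is_ring_hom_def mconst_def single_add mult_single)

lemma mono_eval_mvar: "mono_eval mvar m = Poly_Mapping.single m (1 :: 'c::comm_ring_1)"
proof -
  have pw: "mvar v ^ k = Poly_Mapping.single (Poly_Mapping.single v k) (1 :: 'c)" for v :: 'a and k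
    by (induction k) (simp_all add: mvar_def mult_single flip: single_add)
  have "(\<Prod>v\<in>A. mvar v ^ Poly_Mapping.lookup m v) = Poly_Mapping.single
      (\<Sum>v\<in>A. Poly_Mapping.single v (Poly_Mapping.lookup m v)) (1 :: 'c)" if "finite A" for A
    using that by (induction A) (simp_all add: pw mult_single)
  then show ?thesis
    by (simp add: mono_eval_def flip: poly_mapping_sum_singles)
qed

lemma single_eq_mconst_mult: "Poly_Mapping.single m c = mconst c * mono_eval mvar m"
  by (simp add: mono_eval_mvar mconst_def mult_single)

section \<open>Polynomials in a given set of variables\<close>

lemma polys_in_add: "p \<in> polys_in V \<Longrightarrow> q \<in> polys_in V \<Longrightarrow> p + q \<in> polys_in V"
  using keys_add[of p q] by (auto simp: polys_in_def)

lemma polys_in_uminus: "p \<in> polys_in V \<Longrightarrow> - p \<in> polys_in V"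
  by (auto simp: polys_in_def in_keys_iff)

lemma polys_in_diff: "p \<in> polys_in V \<Longrightarrow> q \<in> polys_in V \<Longrightarrow> p - q \<in> polys_in V"
  using polys_in_add[of p V "- q"] polys_in_uminus[of q V] by simp

lemma polys_in_mult: "p \<in> polys_in V \<Longrightarrow> q \<in> polys_in V \<Longrightarrow> p * q \<in> polys_in V"
  unfolding polys_in_def mem_Collect_eq
proof
  fix m assume V: "\<forall>m\<in>Poly_Mapping.keys p. Poly_Mapping.keys m \<subseteq> V"
    "\<forall>m\<in>Poly_Mapping.keys q. Poly_Mapping.keys m \<subseteq> V" and "m \<in> Poly_Mapping.keys (p * q)"
  then obtain a b where "m = a + b" "a \<in> Poly_Mapping.keys p" "b \<in> Poly_Mapping.keys q"
    using keys_mult[of p q] by blast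
  then show "Poly_Mapping.keys m \<subseteq> V"
    using V keys_add[of a b] by blast
qed

lemma polys_in_mconst: "mconst c \<in> polys_in V"
  by (auto simp: polys_in_def mconst_def split: if_splits)

lemma polys_in_0: "0 \<in> polys_in V" and polys_in_1: "1 \<in> polys_in V"
  using polys_in_mconst[of 0 V] polys_in_mconst[of 1 V] by simp_all

lemma polys_in_mvar: "v \<in> V \<Longrightarrow> mvar v \<in> polys_in V"
  by (auto simp: polys_in_def mvar_def split: if_splits)

lemma polys_in_sum: "(\<And>x. x \<in> A \<Longrightarrow> f x \<in> polys_in V) \<Longrightarrow> sum f A \<in> polys_in V"
  by (induction A rule: infinite_finite_induct) (auto intro: polys_in_0 polys_in_add)

lemma polys_in_prod: "(\<And>x. x \<in> A \<Longrightarrow> f x \<in> polys_in V) \<Longrightarrow> prod f A \<in> polys_in V"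
  by (induction A rule: infinite_finite_induct) (auto intro: polys_in_1 polys_in_mult)

lemma polys_in_power: "p \<in> polys_in V \<Longrightarrow> p ^ k \<in> polys_in V"
  by (induction k) (auto intro: polys_in_1 polys_in_mult)

lemma polys_in_of_nat: "of_nat k \<in> polys_in V"
  by (induction k) (auto intro: polys_in_0 polys_in_1 polys_in_add)

lemma polys_in_mono: "p \<in> polys_in V \<Longrightarrow> V \<subseteq> W \<Longrightarrow> p \<in> polys_in W"
  by (fastforce simp: polys_in_def)

lemmas polys_in_intros = polys_in_add polys_in_uminus polys_in_diff polys_in_mult polys_in_mconst
  polys_in_0 polys_in_1 polys_in_mvar polys_in_sum polys_in_prod polys_in_power polys_in_of_nat

lemma polys_in_UNIV: "p \<in> polys_in UNIV"
  by (simp add: polys_in_def)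

lemma polys_in_induct [consumes 1, case_names const var add mult]:
  assumes p: "p \<in> polys_in V"
    and const: "\<And>c. P (mconst c)"
    and var: "\<And>v. v \<in> V \<Longrightarrow> P (mvar v)"
    and add: "\<And>p q. p \<in> polys_in V \<Longrightarrow> q \<in> polys_in V \<Longrightarrow> P p \<Longrightarrow> P q \<Longrightarrow> P (p + q)"
    and mult: "\<And>p q. p \<in> polys_in V \<Longrightarrow> q \<in> polys_in V \<Longrightarrow> P p \<Longrightarrow> P q \<Longrightarrow> P (p * q)"
  shows "P p"
proof -
  \<comment> \<open>Membership is carried along with \<open>P\<close>, since \<open>add\<close> and
    \<open>mult\<close> demand it of both operands.\<close>
  let ?Q = "\<lambda>p. p \<in> polys_in V \<and> P p"
  have Qpow: "?Q (mvar v ^ k)" if "v \<in> V" for v k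
    using that
    by (induction k) (use const[of 1] in \<open>auto intro!: var mult polys_in_intros\<close>)
  have Qmono: "?Q (mono_eval mvar m)" if m: "Poly_Mapping.keys m \<subseteq> V" for m
  proof -
    have "?Q (\<Prod>v\<in>A. mvar v ^ Poly_Mapping.lookup m v)" if "finite A" "A \<subseteq> V" for A
      using that
    proof (induction A)
      case empty
      then show ?case using const[of 1] by (simp add: polys_in_intros)
    next
      case (insert v A)
      then have "?Q (mvar v ^ Poly_Mapping.lookup m v)"
          "?Q (\<Prod>v\<in>A. mvar v ^ Poly_Mapping.lookup m v)"
        using Qpow by auto
      then show ?case
        using insert by (auto intro: mult polys_in_mult)
    qed
    then show ?thesis using m unfolding mono_eval_def by simp
  qed
  have "?Q p"
  proof (rule poly_mapping_single_induct[where P = ?Q and M = "{m. Poly_Mapping.keys m \<subseteq> V}"])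
    show "?Q 0" using const[of 0] by (simp add: polys_in_intros)
    show "?Q (Poly_Mapping.single m c)" if "m \<in> {m. Poly_Mapping.keys m \<subseteq> V}" for m c
      using Qmono[of m] that const[of c]
      by (auto simp: single_eq_mconst_mult intro!: mult polys_in_intros)
    show "?Q (p + q)" if "?Q p" "?Q q" for p q
      using that by (auto intro: add polys_in_add)
    show "Poly_Mapping.keys p \<subseteq> {m. Poly_Mapping.keys m \<subseteq> V}"
      using p by (auto simp: polys_in_def)
  qed
  then show ?thesis by simp
qed

lemma hom_eqI:
  assumes "is_ring_hom g" "is_ring_hom g'" "p \<in> polys_in V"
    and "\<And>c. g (mconst c) = g' (mconst c)" "\<And>v. v \<in> V \<Longrightarrow> g (mvar v) = g' (mvar v)"
  shows "g p = g' p"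
  using assms(3)
  by (induction rule: polys_in_induct) (simp_all add: assms hom_add[OF assms(1)]
      hom_add[OF assms(2)] hom_mult[OF assms(1)] hom_mult[OF assms(2)])

section \<open>Evaluation and substitution as homomorphisms\<close>

lemma is_ring_hom_peval:
  assumes h: "is_ring_hom h"
  shows "is_ring_hom (peval h f)"
proof -
  have add: "peval h f (p + q) = peval h f p + peval h f q" for p q
    unfolding peval_def
    by (rule setsum_keys_plus_distrib) (simp_all add: hom_0[OF h] hom_add[OF h] algebra_simps)
  have zero: "peval h f 0 = 0"
    by (simp add: peval_def)
  have single: "peval h f (Poly_Mapping.single m c) = h c * mono_eval f m" for m c
    by (simp add: peval_def hom_0[OF h])
  \<comment> \<open>Additivity reduces first the right factor and then, in \<open>mult\<close>, the
    left factor to a monomial.\<close>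
  have mult1: "peval h f (Poly_Mapping.single m c * q)
      = peval h f (Poly_Mapping.single m c) * peval h f q" for m c q
    by (rule poly_mapping_single_induct[where M = UNIV and p = q and P = "\<lambda>q.
          peval h f (Poly_Mapping.single m c * q) = peval h f (Poly_Mapping.single m c) * peval h f q"])
      (simp_all add: zero add single mult_single hom_mult[OF h] mono_eval_add algebra_simps)
  have mult: "peval h f (p * q) = peval h f p * peval h f q" for p q
    by (rule poly_mapping_single_induct[where M = UNIV and p = p])
      (simp_all add: zero add mult1 distrib_right)
  have "peval h f 1 = 1"
    using single[of 0 1] by (simp add: hom_1[OF h])
  then show ?thesis
    by (simp add: is_ring_hom_def add mult)
qed

lemma peval_mconst: "is_ring_hom h \<Longrightarrow> peval h f (mconst c) = h c"
  by (simp add: peval_def mconst_def hom_0)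

lemma peval_mvar: "is_ring_hom h \<Longrightarrow> peval h f (mvar v) = f v"
  by (simp add: peval_def mvar_def hom_1)

lemma hom_peval:
  assumes "is_ring_hom g" "is_ring_hom h"
  shows "g (peval h f p) = peval (\<lambda>x. g (h x)) (\<lambda>v. g (f v)) p"
proof (rule hom_eqI[where p = p and V = UNIV])
  have gh: "is_ring_hom (\<lambda>x. g (h x))"
    using assms by (rule is_ring_hom_comp)
  show "is_ring_hom (\<lambda>p. g (peval h f p))"
    by (rule is_ring_hom_comp[OF assms(1) is_ring_hom_peval[OF assms(2)]])
  show "is_ring_hom (peval (\<lambda>x. g (h x)) (\<lambda>v. g (f v)))"
    by (rule is_ring_hom_peval[OF gh])
qed (simp_all add: polys_in_UNIV peval_mconst peval_mvar assms is_ring_hom_comp)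

lemma peval_cong:
  assumes "p \<in> polys_in V" "\<And>v. v \<in> V \<Longrightarrow> f v = g v"
  shows "peval h f p = peval h g p"
  unfolding peval_def mono_eval_def
proof (intro sum.cong refl, rule arg_cong[where f = "(*) _"], intro prod.cong refl)
  fix m v assume "m \<in> Poly_Mapping.keys p" "v \<in> Poly_Mapping.keys m"
  then show "f v ^ Poly_Mapping.lookup m v = g v ^ Poly_Mapping.lookup m v"
    using assms by (fastforce simp: polys_in_def)
qed

lemma msubst_eq_peval: "msubst = peval mconst"
  by (simp add: fun_eq_iff msubst_def peval_def mono_eval_def)

lemma is_ring_hom_msubst: "is_ring_hom (msubst f)"
  unfolding msubst_eq_peval by (rule is_ring_hom_peval[OF is_ring_hom_mconst])

lemma msubst_mvar [simp]: "msubst f (mvar v) = f v"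
  by (simp add: msubst_eq_peval peval_mvar is_ring_hom_mconst)

lemma msubst_mconst [simp]: "msubst f (mconst c) = mconst c"
  by (simp add: msubst_eq_peval peval_mconst is_ring_hom_mconst)

lemmas msubst_simps [simp] = hom_simps[OF is_ring_hom_msubst]

lemma msubst_cong:
  assumes "p \<in> polys_in V" "\<And>v. v \<in> V \<Longrightarrow> f v = g v"
  shows "msubst f p = msubst g p"
  unfolding msubst_eq_peval using assms by (rule peval_cong)

lemma hom_msubst:
  assumes "is_ring_hom h"
  shows "h (msubst f p) = peval (\<lambda>c. h (mconst c)) (\<lambda>v. h (f v)) p"
  unfolding msubst_eq_peval by (rule hom_peval[OF assms is_ring_hom_mconst])

lemma peval_msubst:
  "is_ring_hom h \<Longrightarrow> peval h f (msubst g p) = peval h (\<lambda>v. peval h f (g v)) p"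
  by (subst hom_msubst) (auto simp: is_ring_hom_peval peval_mconst)

lemma msubst_msubst: "msubst f (msubst g p) = msubst (\<lambda>v. msubst f (g v)) p"
  using peval_msubst[OF is_ring_hom_mconst] by (simp add: msubst_eq_peval)

lemma msubst_id:
  assumes "p \<in> polys_in V" "\<And>v. v \<in> V \<Longrightarrow> f v = mvar v"
  shows "msubst f p = p"
  by (rule hom_eqI[OF is_ring_hom_msubst is_ring_hom_id assms(1)]) (use assms(2) in auto)

lemma polys_in_msubst:
  assumes "p \<in> polys_in V" "\<And>v. v \<in> V \<Longrightarrow> f v \<in> polys_in W"
  shows "msubst f p \<in> polys_in W"
  using assms(1) by (induction rule: polys_in_induct) (auto intro: polys_in_intros assms)

section \<open>Integral polynomials inside rational ones\<close>

lemma lookup_to_rat: "Poly_Mapping.lookup (to_rat p) m = of_int (Poly_Mapping.lookup p m)"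
  unfolding to_rat_def by transfer (auto simp: when_def)

lemma to_rat_inject: "to_rat p = to_rat q \<longleftrightarrow> p = q"
  by (auto simp: poly_mapping_eq_iff fun_eq_iff lookup_to_rat)

lemma keys_to_rat: "Poly_Mapping.keys (to_rat p) = Poly_Mapping.keys p"
  by (auto simp: in_keys_iff lookup_to_rat)

lemma to_rat_in_polys_in_iff: "to_rat p \<in> polys_in V \<longleftrightarrow> p \<in> polys_in V"
  by (simp add: polys_in_def keys_to_rat)

lemma to_rat_single: "to_rat (Poly_Mapping.single m c) = Poly_Mapping.single m (of_int c)"
  by (simp add: to_rat_def)

lemma to_rat_mvar [simp]: "to_rat (mvar v) = mvar v"
  and to_rat_mconst [simp]: "to_rat (mconst c) = mconst (of_int c)"
  by (simp_all add: mvar_def mconst_def to_rat_single)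

lemma to_rat_eq_peval: "to_rat = peval (\<lambda>c. mconst (of_int c)) mvar"
proof (rule ext)
  fix p :: "('a, int) mpoly"
  have add: "to_rat (p + q) = to_rat p + to_rat q" for p q :: "('a, int) mpoly"
    by (rule poly_mapping_eqI) (simp add: lookup_to_rat lookup_add)
  let ?h = "peval (\<lambda>c. mconst (of_int c) :: ('a, rat) mpoly) mvar"
  have h: "is_ring_hom ?h"
    by (intro is_ring_hom_peval is_ring_hom_comp[OF is_ring_hom_mconst]
        is_ring_hom_of_int)
  have single: "?h (Poly_Mapping.single m c) = to_rat (Poly_Mapping.single m c)" for m c
    by (simp add: peval_def mono_eval_mvar mconst_def mult_single to_rat_single
        del: single_of_int)
  show "to_rat p = ?h p"
    by (rule poly_mapping_single_induct[where M = UNIV and p = p and P = "\<lambda>p. to_rat p = ?h p"])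
      (simp_all only: single hom_0[OF h] hom_add[OF h] add to_rat_single[of 0 0, simplified]
        subset_UNIV)
qed

lemma is_ring_hom_mconst_of_int: "is_ring_hom (\<lambda>c. mconst (of_int c))"
  by (intro is_ring_hom_comp[OF is_ring_hom_mconst] is_ring_hom_of_int)

lemma is_ring_hom_to_rat: "is_ring_hom to_rat"
  unfolding to_rat_eq_peval by (rule is_ring_hom_peval[OF is_ring_hom_mconst_of_int])

lemmas to_rat_simps [simp] = hom_simps[OF is_ring_hom_to_rat]

lemma to_rat_msubst: "to_rat (msubst f p) = msubst (\<lambda>v. to_rat (f v)) (to_rat p)"
  by (rule hom_eqI[where p = p and V = UNIV,
        OF is_ring_hom_comp[OF is_ring_hom_to_rat is_ring_hom_msubst]
          is_ring_hom_comp[OF is_ring_hom_msubst is_ring_hom_to_rat]])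
    (simp_all add: polys_in_UNIV)


section \<open>Newton's identities and opposite power series\<close>

text \<open>Newton's identities between elementary symmetric functions \<open>e\<close> and power
  sums \<open>p\<close>. They constrain \<open>p\<close> only from index 1 on.\<close>

definition newton :: "(nat \<Rightarrow> 'r::comm_ring_1) \<Rightarrow> (nat \<Rightarrow> 'r) \<Rightarrow> bool" where
  "newton e p \<longleftrightarrow> e 0 = 1 \<and>
     (\<forall>n. of_nat (Suc n) * e (Suc n) = (\<Sum>i\<le>n. (-1) ^ i * e (n - i) * p (Suc i)))"

definition conv :: "(nat \<Rightarrow> 'r::comm_ring_1) \<Rightarrow> (nat \<Rightarrow> 'r) \<Rightarrow> nat \<Rightarrow> 'r" where
  "conv a b n = (\<Sum>i\<le>n. a i * b (n - i))"

lemma Abs_fps_conv: "Abs_fps (conv a b) = Abs_fps a * Abs_fps b"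
  by (simp add: fps_eq_iff fps_mult_nth conv_def atLeast0AtMost)

text \<open>The defining relation says that the power sum series is the logarithmic derivative of
  \<open>\<Sum>n. e n t\<^sup>n\<close>.\<close>

lemma newton_iff_fps:
  "newton e p \<longleftrightarrow> e 0 = 1 \<and>
     fps_deriv (Abs_fps e) = Abs_fps e * Abs_fps (\<lambda>i. (-1) ^ i * p (Suc i))"
proof -
  have "(\<Sum>i\<le>n. (-1) ^ i * e (n - i) * p (Suc i))
      = (\<Sum>i\<le>n. e i * ((-1) ^ (n - i) * p (Suc (n - i))))" for n
    by (rule sum.reindex_bij_witness[of _ "\<lambda>i. n - i" "\<lambda>i. n - i"]) (auto simp: mult_ac)
  then show ?thesis
    by (simp add: newton_def fps_eq_iff fps_mult_nth atLeast0AtMost)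
qed

text \<open>The logarithmic derivative of a product is the sum of the logarithmic
  derivatives.\<close>

lemma newton_conv:
  assumes "newton e p" "newton e' p'"
  shows "newton (conv e e') (\<lambda>n. p n + p' n)"
proof -
  have "fps_deriv (Abs_fps e * Abs_fps e')
      = Abs_fps e * Abs_fps e' * Abs_fps (\<lambda>i. (-1) ^ i * (p (Suc i) + p' (Suc i)))"
  proof -
    have "Abs_fps (\<lambda>i. (-1) ^ i * (p (Suc i) + p' (Suc i)))
        = Abs_fps (\<lambda>i. (-1) ^ i * p (Suc i)) + Abs_fps (\<lambda>i. (-1) ^ i * p' (Suc i))"
      by (simp add: fps_eq_iff algebra_simps)
    with assms show ?thesis
      by (simp add: newton_iff_fps algebra_simps)
  qed
  moreover have "conv e e' 0 = 1"
    using assms by (simp add: conv_def newton_def)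
  ultimately show ?thesis
    by (simp add: newton_iff_fps Abs_fps_conv)
qed

lemma newton_one: "newton (\<lambda>n. if n = 0 then 1 else 0) (\<lambda>_. 0)"
  by (simp add: newton_def)

lemma newton_linear: "newton (coeff [:1, x:]) (\<lambda>n. x ^ n)"
proof -
  have "(\<Sum>i\<le>n. (- 1) ^ i * coeff [:1, x:] (n - i) * x ^ Suc i) =
      of_nat (Suc n) * coeff [:1, x:] (Suc n)" for n
  proof (cases n)
    case (Suc k)
    \<comment> \<open>Only the terms with index \<open>k\<close> and \<open>Suc k\<close> survive,
      and they cancel.\<close>
    have "(\<Sum>i\<le>n. (- 1) ^ i * coeff [:1, x:] (n - i) * x ^ Suc i)
        = (\<Sum>i\<in>{k, Suc k}. (- 1) ^ i * coeff [:1, x:] (n - i) * x ^ Suc i)"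
      by (rule sum.mono_neutral_right)
        (auto simp: Suc coeff_pCons split: nat.splits)
    then show ?thesis
      by (simp add: Suc coeff_pCons)
  qed simp
  then show ?thesis
    by (simp add: newton_def del: power_Suc)
qed

lemma newton_prod_linear:
  assumes "finite A"
  shows "newton (coeff (\<Prod>a\<in>A. [:1, x a:])) (\<lambda>n. \<Sum>a\<in>A. x a ^ n)"
  using assms
proof (induction A)
  case empty
  have "coeff (1 :: 'b poly) = (\<lambda>n. if n = 0 then 1 else 0)"
    by (auto simp: fun_eq_iff)
  then show ?case using newton_one by simp
next
  case (insert a A)
  have "coeff ([:1, x a:] * (\<Prod>a\<in>A. [:1, x a:]))
      = conv (coeff [:1, x a:]) (coeff (\<Prod>a\<in>A. [:1, x a:]))"
    by (rule ext, subst coeff_mult) (simp only: conv_def)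
  then show ?case
    using newton_conv[OF newton_linear insert.IH] insert.hyps by simp
qed

lemma newton_hom:
  assumes "is_ring_hom g" "newton e p"
  shows "newton (\<lambda>n. g (e n)) (\<lambda>n. g (p n))"
proof -
  have "g (of_nat (Suc n) * e (Suc n)) = g (\<Sum>i\<le>n. (-1) ^ i * e (n - i) * p (Suc i))" for n
    using assms(2) by (simp add: newton_def)
  then show ?thesis
    using assms(2) by (simp add: newton_def hom_simps[OF assms(1)] del: of_nat_Suc)
qed

text \<open>This works over any ring: since \<open>e 0 = 1\<close>, the newest power sum enters each
  identity with the invertible coefficient \<open>(-1) ^ k\<close>.\<close>

lemma newton_unique_power_sum:
  assumes "newton e p" "newton e p'" "n \<ge> 1"
  shows "p n = p' n"
  using assms(3)
proof (induction n rule: less_induct)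
  case (less n)
  then obtain k where n: "n = Suc k" by (cases n) auto
  have "(\<Sum>i\<le>k. (-1) ^ i * e (k - i) * p (Suc i)) = (\<Sum>i\<le>k. (-1) ^ i * e (k - i) * p' (Suc i))"
    using assms(1,2) by (simp add: newton_def)
  moreover have "(\<Sum>i<k. (-1) ^ i * e (k - i) * p (Suc i)) = (\<Sum>i<k. (-1) ^ i * e (k - i) * p' (Suc i))"
    using less.IH by (intro sum.cong) (auto simp: n)
  ultimately have eq: "(-1) ^ k * p (Suc k) = (-1) ^ k * p' (Suc k)"
    using assms(1,2) by (simp add: newton_def flip: lessThan_Suc_atMost)
  have "(-1) ^ k * ((-1) ^ k * x) = x" for x :: 'a
    by (simp flip: mult.assoc power_mult_distrib)
  then show ?case
    using arg_cong[OF eq, of "\<lambda>x. (-1) ^ k * x"] by (simp add: n)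
qed

lemma mconst_inverse_of_nat:
  "n \<ge> 1 \<Longrightarrow> mconst (1 / of_nat n) * of_nat n = (1 :: ('v, rat) mpoly)"
  by (simp add: mconst_def mult_single flip: single_of_nat)

text \<open>Recovering \<open>e\<close> from \<open>p\<close> means dividing by \<open>n\<close>,
  hence the rational coefficients.\<close>

lemma newton_unique_elementary:
  fixes e e' p :: "nat \<Rightarrow> ('v, rat) mpoly"
  assumes "newton e p" "newton e' p"
  shows "e n = e' n"
proof (induction n rule: less_induct)
  case (less n)
  show ?case
  proof (cases n)
    case 0
    then show ?thesis using assms by (simp add: newton_def)
  next
    case (Suc k)
    have "(\<Sum>i\<le>k. (-1) ^ i * e (k - i) * p (Suc i)) = (\<Sum>i\<le>k. (-1) ^ i * e' (k - i) * p (Suc i))"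
      using less.IH by (intro sum.cong) (auto simp: Suc)
    then have "of_nat n * e n = of_nat n * e' n"
      using assms by (simp add: newton_def Suc)
    then have "mconst (1 / of_nat n) * of_nat n * e n = mconst (1 / of_nat n) * of_nat n * e' n"
      by (simp add: mult.assoc)
    then show ?thesis
      by (subst (asm) (1 2) mconst_inverse_of_nat) (use Suc in simp_all)
  qed
qed

section \<open>Explicit solutions of Newton's identities\<close>

lemma newton_L_poly: "newton (\<lambda>n. msubst p (L_poly n)) p" for p :: "nat \<Rightarrow> ('v, rat) mpoly"
  unfolding newton_def
proof (intro conjI allI)
  show "msubst p (L_poly 0) = 1"
    by (simp add: L_poly.simps)
next
  fix n
  have L: "of_nat (Suc n) * L_poly (Suc n) =
      (\<Sum>i\<le>n. (-1) ^ i * L_poly (n - i) * mvar (Suc i))"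
  proof (cases "n = 0")
    case True
    then show ?thesis by (simp add: L_poly.simps)
  next
    case False
    have "of_nat (Suc n) * L_poly (Suc n) = mconst (1 / of_nat (Suc n)) * of_nat (Suc n) *
        ((-1) ^ n * mvar (Suc n) +
          (\<Sum>i\<in>{1..<Suc n}. (-1) ^ (i - 1) * L_poly (Suc n - i) * mvar i))"
      using False by (subst L_poly.simps) (simp del: of_nat_Suc add: mult_ac)
    also have "\<dots> = (-1) ^ n * mvar (Suc n) +
          (\<Sum>i\<in>{1..<Suc n}. (-1) ^ (i - 1) * L_poly (Suc n - i) * mvar i)"
      by (subst mconst_inverse_of_nat) simp_all
    also have "(\<Sum>i\<in>{1..<Suc n}. (-1) ^ (i - 1) * L_poly (Suc n - i) * mvar i) =
        (\<Sum>i<n. (-1) ^ i * L_poly (n - i) * mvar (Suc i))"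
      by (rule sum.reindex_bij_witness[of _ Suc "\<lambda>i. i - 1"]) auto
    finally show ?thesis
      by (simp add: L_poly.simps[of 0] add.commute flip: lessThan_Suc_atMost)
  qed
  show "of_nat (Suc n) * msubst p (L_poly (Suc n)) =
      (\<Sum>i\<le>n. (-1) ^ i * msubst p (L_poly (n - i)) * p (Suc i))"
    using arg_cong[OF L, of "msubst p"] by (simp del: of_nat_Suc)
qed

lemma newton_imp_L_poly:
  fixes e p :: "nat \<Rightarrow> ('v, rat) mpoly"
  shows "newton e p \<Longrightarrow> e n = msubst p (L_poly n)"
  using newton_unique_elementary newton_L_poly by blast

text \<open>Newton's identities solved for the power sum. This is an explicit integral candidate for
  \<open>N_poly\<close>, which itself is given by a definite description.\<close>

fun newton_poly :: "nat \<Rightarrow> (nat, int) mpoly" where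
  "newton_poly n = (if n = 0 then 0 else
     (-1) ^ (n - 1) * (of_nat n * mvar n - (\<Sum>i\<in>{1..<n}. (-1) ^ (i - 1) * mvar (n - i) * newton_poly i)))"

declare newton_poly.simps [simp del]

lemma newton_newton_poly:
  assumes h: "is_ring_hom h" and e0: "e 0 = 1"
  shows "newton e (\<lambda>n. peval h e (newton_poly n))"
  unfolding newton_def
proof (intro conjI allI e0)
  fix n
  note hom = hom_simps[OF is_ring_hom_peval[OF h]] peval_mvar[OF h]
  let ?p = "\<lambda>n. peval h e (newton_poly n)"
  have "(\<Sum>i\<in>{1..<Suc n}. (-1) ^ (i - 1) * e (Suc n - i) * ?p i) =
      (\<Sum>i<n. (-1) ^ i * e (n - i) * ?p (Suc i))"
    by (rule sum.reindex_bij_witness[of _ Suc "\<lambda>i. i - 1"]) auto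
  then have "?p (Suc n) = (-1) ^ n * (of_nat (Suc n) * e (Suc n)
      - (\<Sum>i<n. (-1) ^ i * e (n - i) * ?p (Suc i)))"
    by (subst newton_poly.simps) (simp add: hom del: of_nat_Suc sum.op_ivl_Suc)
  then have "(-1) ^ n * ?p (Suc n) = (-1) ^ n * (-1) ^ n * (of_nat (Suc n) * e (Suc n)
      - (\<Sum>i<n. (-1) ^ i * e (n - i) * ?p (Suc i)))"
    by (simp only: mult.assoc)
  then have "(-1) ^ n * ?p (Suc n) = of_nat (Suc n) * e (Suc n)
      - (\<Sum>i<n. (-1) ^ i * e (n - i) * ?p (Suc i))"
    by (simp del: of_nat_Suc flip: power_mult_distrib)
  then show "of_nat (Suc n) * e (Suc n) = (\<Sum>i\<le>n. (-1) ^ i * e (n - i) * ?p (Suc i))"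
    by (simp add: e0 del: of_nat_Suc flip: lessThan_Suc_atMost)
qed

lemma newton_imp_newton_poly:
  assumes "is_ring_hom h" "newton e p" "n \<ge> 1"
  shows "p n = peval h e (newton_poly n)"
  using newton_unique_power_sum[OF assms(2) newton_newton_poly[OF assms(1)] assms(3)] assms(2)
  by (simp add: newton_def)

lemma newton_poly_in: "newton_poly n \<in> polys_in {1..n}"
proof (induction n rule: less_induct)
  case (less n)
  have "newton_poly i \<in> polys_in {1..n}" if "i < n" for i
    using less.IH[OF that] by (rule polys_in_mono) (use that in auto)
  then show ?case
    by (subst newton_poly.simps) (auto intro!: polys_in_intros)
qed

lemma L_poly_in: "L_poly n \<in> polys_in {1..n}"
proof (induction n rule: less_induct)
  case (less n)
  have "L_poly i \<in> polys_in {1..n}" if "i < n" for i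
    using less.IH[OF that] by (rule polys_in_mono) (use that in auto)
  then show ?case
    by (subst L_poly.simps) (auto intro!: polys_in_intros)
qed

lemma Pop_poly_in: "Pop_poly n \<in> polys_in {1..n}"
proof (induction n rule: less_induct)
  case (less n)
  have "Pop_poly i \<in> polys_in {1..n}" if "i < n" for i
    using less.IH[OF that] by (rule polys_in_mono) (use that in auto)
  then show ?case
    by (subst Pop_poly.simps) (auto intro!: polys_in_intros)
qed

text \<open>Turns a substitution into \<open>to_rat p\<close> into an evaluation of the integral
  \<open>p\<close>, to which the results for an arbitrary coefficient map apply.\<close>

lemma msubst_to_rat: "msubst f (to_rat p) = peval (\<lambda>c. mconst (of_int c)) f p"
  by (subst to_rat_eq_peval, subst hom_peval[OF is_ring_hom_msubst is_ring_hom_mconst_of_int])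
    simp

lemma newton_poly_L_poly:
  fixes p :: "nat \<Rightarrow> ('v, rat) mpoly"
  assumes "n \<ge> 1"
  shows "msubst (\<lambda>k. msubst p (L_poly k)) (to_rat (newton_poly n)) = p n"
  unfolding msubst_to_rat
  by (rule newton_imp_newton_poly[OF is_ring_hom_mconst_of_int newton_L_poly assms, symmetric])

text \<open>With \<open>newton_poly_L_poly\<close>, this makes the passages between power sums and
  elementary symmetric functions mutually inverse substitutions.\<close>

lemma L_poly_newton_poly:
  fixes e :: "nat \<Rightarrow> ('v, rat) mpoly"
  assumes "n \<ge> 1"
  shows "msubst (\<lambda>k. msubst e (to_rat (newton_poly k))) (L_poly n) = e n"
proof -
  \<comment> \<open>Newton's identities demand the value 1 at index 0, a variable that occurs in
    none of the polynomials involved.\<close>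
  let ?e = "e(0 := 1)"
  have "msubst e (to_rat (newton_poly k)) = msubst ?e (to_rat (newton_poly k))" for k
    using newton_poly_in by (intro msubst_cong[where V = "{1..k}"]) (auto simp: to_rat_in_polys_in_iff)
  moreover have "newton ?e (\<lambda>k. msubst ?e (to_rat (newton_poly k)))"
    unfolding msubst_to_rat by (rule newton_newton_poly[OF is_ring_hom_mconst_of_int]) simp
  ultimately show ?thesis
    using newton_imp_L_poly[of ?e _ n] assms by simp
qed

section \<open>Elementary symmetric polynomials\<close>

text \<open>Expanding the product picks 1 or the linear term from each factor; \<open>S\<close> is
  the set of factors that contribute the linear term.\<close>

lemma coeff_prod_linear:
  assumes "finite V"
  shows "coeff (\<Prod>v\<in>V. [:1, f v:]) k = (\<Sum>S | S \<subseteq> V \<and> card S = k. \<Prod>v\<in>S. f v)"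
proof -
  have eq: "(\<Prod>v\<in>S. [:0, f v:]) = monom (\<Prod>v\<in>S. f v) (card S)" if "finite S" for S
    using that by (induction S) (simp_all add: monom_Suc mult_monom flip: monom_0)
  have "(\<Prod>v\<in>V. [:1, f v:]) = (\<Prod>v\<in>V. [:0, f v:] + 1)"
    by (simp add: one_pCons)
  also have "\<dots> = (\<Sum>S\<in>Pow V. \<Prod>v\<in>S. [:0, f v:])"
    using prod_add[OF assms, of "\<lambda>v. [:0, f v:]" "\<lambda>_. 1"] by simp
  also have "\<dots> = (\<Sum>S\<in>Pow V. monom (\<Prod>v\<in>S. f v) (card S))"
    using assms by (intro sum.cong) (auto intro!: eq finite_subset[OF _ assms])
  finally have "coeff (\<Prod>v\<in>V. [:1, f v:]) k = (\<Sum>S\<in>Pow V. if card S = k then \<Prod>v\<in>S. f v else 0)"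
    by (simp add: coeff_sum)
  also have "\<dots> = (\<Sum>S\<in>Pow V \<inter> {S. card S = k}. \<Prod>v\<in>S. f v)"
    using assms by (subst sum.inter_restrict) simp_all
  finally show ?thesis
    by (simp add: Pow_def Collect_conj_eq)
qed

lemma esym_eq_coeff: "finite V \<Longrightarrow> esym V = coeff (\<Prod>v\<in>V. [:1, mvar v:])"
  by (simp add: fun_eq_iff esym_def coeff_prod_linear)

lemma newton_esym: "finite V \<Longrightarrow> newton (esym V) (\<lambda>n. \<Sum>v\<in>V. mvar v ^ n)"
  by (simp add: esym_eq_coeff newton_prod_linear)

section \<open>Opposite power series\<close>

text \<open>The series of \<open>b\<close> at t is inverse to the series of \<open>a\<close> at -t,
  which is how \<lambda> and \<sigma> are related.\<close>

definition opposite :: "(nat \<Rightarrow> 'r::comm_ring_1) \<Rightarrow> (nat \<Rightarrow> 'r) \<Rightarrow> bool" where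
  "opposite a b \<longleftrightarrow> Abs_fps b * Abs_fps (\<lambda>i. (-1) ^ i * a i) = 1"

lemma opposite_iff:
  "opposite a b \<longleftrightarrow> (\<forall>n. (\<Sum>i\<le>n. b i * ((-1) ^ (n - i) * a (n - i))) = (if n = 0 then 1 else 0))"
  by (simp add: opposite_def fps_eq_iff fps_mult_nth atLeast0AtMost)

text \<open>Replacing t by -t exchanges the two series; this is carried out coefficient by
  coefficient.\<close>

lemma opposite_sym:
  assumes "opposite a b"
  shows "opposite b a"
  unfolding opposite_iff
proof
  fix n
  have "(\<Sum>i\<le>n. a i * ((-1) ^ (n - i) * b (n - i))) = (\<Sum>i\<le>n. a (n - i) * ((-1) ^ i * b i))"
    by (rule sum.reindex_bij_witness[of _ "\<lambda>i. n - i" "\<lambda>i. n - i"]) auto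
  also have "\<dots> = (\<Sum>i\<le>n. (-1) ^ n * (b i * ((-1) ^ (n - i) * a (n - i))))"
  proof (intro sum.cong refl)
    fix i assume "i \<in> {..n}"
    then have "n + (n - i) = i + 2 * (n - i)" by simp
    then have sign: "(-1) ^ n * (-1) ^ (n - i) = ((-1) ^ i :: 'a)"
      by (metis power_add power_minus1_even mult.right_neutral)
    show "a (n - i) * ((-1) ^ i * b i) = (-1) ^ n * (b i * ((-1) ^ (n - i) * a (n - i)))"
      unfolding sign[symmetric] by (simp only: mult_ac)
  qed
  also have "\<dots> = (if n = 0 then 1 else 0)"
    using assms by (simp add: opposite_iff flip: sum_distrib_left)
  finally show "(\<Sum>i\<le>n. a i * ((-1) ^ (n - i) * b (n - i))) = (if n = 0 then 1 else 0)" .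
qed

lemma opposite_unique:
  assumes "opposite a b" "opposite a b'"
  shows "b = b'"
proof -
  let ?a = "Abs_fps (\<lambda>i. (-1) ^ i * a i)"
  have "Abs_fps b = Abs_fps b * (Abs_fps b' * ?a)"
    using assms(2) by (simp add: opposite_def)
  also have "\<dots> = Abs_fps b' * (Abs_fps b * ?a)"
    by (rule mult.left_commute)
  also have "\<dots> = Abs_fps b'"
    using assms(1) by (simp add: opposite_def)
  finally show ?thesis by (simp add: fps_eq_iff fun_eq_iff)
qed

text \<open>Replacing t by -t is multiplicative, so the product of two inverses is the inverse of
  the product.\<close>

lemma opposite_conv:
  assumes "opposite a b" "opposite a' b'"
  shows "opposite (conv a a') (conv b b')"
proof -
  have "(-1) ^ n * conv a a' n = conv (\<lambda>i. (-1) ^ i * a i) (\<lambda>i. (-1) ^ i * a' i) n" for n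
    unfolding conv_def sum_distrib_left
  proof (intro sum.cong refl)
    fix i assume "i \<in> {..n}"
    then have "(-1) ^ n = (-1) ^ i * ((-1) ^ (n - i) :: 'a)"
      by (simp flip: power_add)
    then show "(-1) ^ n * (a i * a' (n - i)) = (-1) ^ i * a i * ((-1) ^ (n - i) * a' (n - i))"
      by (simp add: mult_ac)
  qed
  then have "Abs_fps (\<lambda>n. (-1) ^ n * conv a a' n)
      = Abs_fps (\<lambda>i. (-1) ^ i * a i) * Abs_fps (\<lambda>i. (-1) ^ i * a' i)"
    by (simp flip: Abs_fps_conv)
  then have "Abs_fps (conv b b') * Abs_fps (\<lambda>n. (-1) ^ n * conv a a' n)
      = (Abs_fps b * Abs_fps (\<lambda>i. (-1) ^ i * a i)) * (Abs_fps b' * Abs_fps (\<lambda>i. (-1) ^ i * a' i))"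
    by (simp add: Abs_fps_conv mult_ac)
  then show ?thesis
    using assms by (simp add: opposite_def)
qed

text \<open>The recursion of \<open>Pop_poly\<close> is the coefficient equation of the inverse
  series, solved for its last term.\<close>

lemma opposite_Pop_poly:
  assumes h: "is_ring_hom h" and a0: "a 0 = 1"
  shows "opposite a (\<lambda>n. peval h a (Pop_poly n))"
  unfolding opposite_iff
proof
  fix n
  note hom = hom_simps[OF is_ring_hom_peval[OF h]] peval_mvar[OF h]
  let ?b = "\<lambda>n. peval h a (Pop_poly n)"
  show "(\<Sum>i\<le>n. ?b i * ((-1) ^ (n - i) * a (n - i))) = (if n = 0 then 1 else 0)"
  proof (cases "n = 0")
    case True
    then show ?thesis by (simp add: Pop_poly.simps hom a0)
  next
    case False
    then have "?b n = (\<Sum>i<n. (-1) ^ (n - i + 1) * ?b i * a (n - i))"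
      by (subst Pop_poly.simps) (simp add: hom)
    also have "\<dots> = - (\<Sum>i<n. ?b i * ((-1) ^ (n - i) * a (n - i)))"
      by (simp add: mult_ac flip: sum_negf)
    finally show ?thesis
      using False by (simp add: a0 flip: lessThan_Suc_atMost)
  qed
qed

text \<open>Passing to the opposite twice changes nothing, by symmetry and uniqueness of
  \<open>opposite\<close>.\<close>

lemma Pop_poly_Pop_poly:
  assumes h: "is_ring_hom h" and n: "n \<ge> 1"
  shows "peval h (\<lambda>k. peval h a (Pop_poly k)) (Pop_poly n) = a n"
proof -
  let ?a = "a(0 := 1)"
  let ?b = "\<lambda>k. peval h ?a (Pop_poly k)"
  have b: "opposite ?a ?b"
    by (rule opposite_Pop_poly[OF h]) simp
  have b0: "?b 0 = 1"
    by (simp add: Pop_poly.simps hom_1[OF is_ring_hom_peval[OF h]])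
  have eq: "peval h a (Pop_poly k) = ?b k" for k
    using Pop_poly_in by (rule peval_cong) auto
  have "?a n = peval h ?b (Pop_poly n)"
    by (rule fun_cong[OF opposite_unique[OF opposite_sym[OF b] opposite_Pop_poly[OF h, of ?b, OF b0]]])
  then show ?thesis
    using n by (simp add: eq)
qed


section \<open>Integrality by Kronecker substitution\<close>

text \<open>Among the indices with coefficient outside \<open>A\<close>, take the one of largest
  degree and compare coefficients in that degree: the other bad indices contribute 0 and the good
  ones an element of \<open>A\<close>, so the leading coefficient 1 puts the bad coefficient into
  \<open>A\<close>. With \<open>A\<close> the integers this yields integrality, with
  \<open>A = {0}\<close> uniqueness.\<close>

lemma coeffs_in_subgroup:
  fixes c :: "'m \<Rightarrow> rat" and G :: "'m \<Rightarrow> rat poly"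
  assumes fin: "finite M" and monic: "\<And>m. m \<in> M \<Longrightarrow> lead_coeff (G m) = 1"
    and inj: "inj_on (\<lambda>m. degree (G m)) M"
    and int: "\<And>m d. m \<in> M \<Longrightarrow> coeff (G m) d \<in> \<int>"
    and A: "0 \<in> A" "\<And>a b. a \<in> A \<Longrightarrow> b \<in> A \<Longrightarrow> a + b \<in> A" "\<And>a k. a \<in> A \<Longrightarrow> of_int k * a \<in> A"
    and sum: "\<And>d. (\<Sum>m\<in>M. c m * coeff (G m) d) \<in> A"
    and m: "m \<in> M"
  shows "c m \<in> A"
proof (rule ccontr)
  assume "c m \<notin> A"
  define N where "N = {m \<in> M. c m \<notin> A}"
  have "finite N" "N \<noteq> {}"
    using fin m \<open>c m \<notin> A\<close> by (auto simp: N_def)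
  then have "Max ((\<lambda>m. degree (G m)) ` N) \<in> (\<lambda>m. degree (G m)) ` N"
    by (intro Max_in) auto
  then obtain x where x: "x \<in> N" and x_max: "degree (G x) = Max ((\<lambda>m. degree (G m)) ` N)"
    by auto
  have max: "degree (G y) \<le> degree (G x)" if "y \<in> N" for y
    unfolding x_max using that \<open>finite N\<close> by (intro Max_ge) auto
  let ?d = "degree (G x)"
  have A_sum: "(\<Sum>m\<in>S. g m) \<in> A" if "\<And>m. m \<in> S \<Longrightarrow> g m \<in> A" for S and g :: "'m \<Rightarrow> rat"
    using that by (induction S rule: infinite_finite_induct) (auto intro: A)
  have A_int: "a * z \<in> A" if "a \<in> A" "z \<in> \<int>" for a z
    using that A(3)[of a] by (auto simp: mult.commute elim!: Ints_cases)
  have "(\<Sum>m\<in>M - N. c m * coeff (G m) ?d) \<in> A"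
    by (intro A_sum A_int int) (auto simp: N_def)
  then have "of_int (-1) * (\<Sum>m\<in>M - N. c m * coeff (G m) ?d) \<in> A"
    by (rule A(3))
  then have "of_int (-1) * (\<Sum>m\<in>M - N. c m * coeff (G m) ?d) + (\<Sum>m\<in>M. c m * coeff (G m) ?d) \<in> A"
    using sum by (intro A(2))
  moreover have "(\<Sum>m\<in>M. c m * coeff (G m) ?d)
      = (\<Sum>m\<in>M - N. c m * coeff (G m) ?d) + (\<Sum>m\<in>N. c m * coeff (G m) ?d)"
    using fin by (intro sum.subset_diff) (auto simp: N_def)
  moreover have "(\<Sum>m\<in>N. c m * coeff (G m) ?d) = (\<Sum>m\<in>{x}. c m * coeff (G m) ?d)"
  proof (rule sum.mono_neutral_right[OF \<open>finite N\<close>])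
    show "\<forall>y\<in>N - {x}. c y * coeff (G y) ?d = 0"
    proof
      fix y assume y: "y \<in> N - {x}"
      then have "degree (G y) \<noteq> ?d"
        using inj x by (auto simp: N_def inj_on_def)
      then show "c y * coeff (G y) ?d = 0"
        using max[of y] y by (auto intro!: coeff_eq_0)
    qed
  qed (use x in auto)
  ultimately show False
    using x monic[of x] by (simp add: N_def)
qed

lemma mono_eval_monom: "mono_eval (\<lambda>w. monom 1 (d w)) m
    = monom 1 (\<Sum>w\<in>Poly_Mapping.keys m. Poly_Mapping.lookup m w * d w)"
proof -
  have "(\<Prod>w\<in>S. monom 1 (d w) ^ Poly_Mapping.lookup m w)
      = monom 1 (\<Sum>w\<in>S. Poly_Mapping.lookup m w * d w)" for S
    by (induction S rule: infinite_finite_induct)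
      (simp_all add: monom_power mult_monom mult.commute)
  then show ?thesis by (simp add: mono_eval_def)
qed

definition kronecker :: "('w \<Rightarrow> nat) \<Rightarrow> ('w, rat) mpoly \<Rightarrow> rat poly" where
  "kronecker d = peval (\<lambda>c. [:c:]) (\<lambda>w. monom 1 (d w))"

lemma is_ring_hom_pCons: "is_ring_hom (\<lambda>c. [:c:])"
  by (simp add: is_ring_hom_def)

lemma is_ring_hom_kronecker: "is_ring_hom (kronecker d)"
  unfolding kronecker_def by (rule is_ring_hom_peval[OF is_ring_hom_pCons])

lemma coeff_kronecker_in:
  assumes A: "0 \<in> A" "\<And>a b. a \<in> A \<Longrightarrow> b \<in> A \<Longrightarrow> a + b \<in> A"
    and R: "\<And>m. Poly_Mapping.lookup R m \<in> A"
  shows "coeff (kronecker d R) k \<in> A"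
proof -
  have A_sum: "(\<Sum>m\<in>S. g m) \<in> A" if "\<And>m. m \<in> S \<Longrightarrow> g m \<in> A" for S and g :: "'b \<Rightarrow> rat"
    using that by (induction S rule: infinite_finite_induct) (auto intro: A)
  show ?thesis
    unfolding kronecker_def peval_def coeff_sum mono_eval_monom
    by (intro A_sum) (use A R in auto)
qed

text \<open>Monomials in the \<open>f v\<close> become products of monic polynomials, hence monic,
  and their degrees are the weights assumed distinct; so \<open>coeffs_in_subgroup\<close>
  applies.\<close>

lemma kronecker_in_subgroup:
  fixes Q :: "('v, rat) mpoly" and f :: "'v \<Rightarrow> ('w, int) mpoly"
  assumes Q: "Q \<in> polys_in V"
    and inj: "inj_on (\<lambda>m. \<Sum>v\<in>Poly_Mapping.keys m. Poly_Mapping.lookup m v * D v) (Poly_Mapping.keys Q)"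
    and monic: "\<And>v. v \<in> V \<Longrightarrow> lead_coeff (kronecker d (to_rat (f v))) = 1"
    and deg: "\<And>v. v \<in> V \<Longrightarrow> degree (kronecker d (to_rat (f v))) = D v"
    and A: "0 \<in> A" "\<And>a b. a \<in> A \<Longrightarrow> b \<in> A \<Longrightarrow> a + b \<in> A" "\<And>a k. a \<in> A \<Longrightarrow> of_int k * a \<in> A"
    and QA: "\<And>m. Poly_Mapping.lookup (msubst (\<lambda>v. to_rat (f v)) Q) m \<in> A"
  shows "Poly_Mapping.lookup Q m \<in> A"
proof (cases "m \<in> Poly_Mapping.keys Q")
  case False
  then show ?thesis using A(1) by (simp add: in_keys_iff)
next
  case True
  let ?G = "\<lambda>m. kronecker d (to_rat (mono_eval f m))"
  note hom = hom_simps[OF is_ring_hom_kronecker]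
  have G: "?G m = (\<Prod>v\<in>Poly_Mapping.keys m. kronecker d (to_rat (f v)) ^ Poly_Mapping.lookup m v)" for m
    by (simp add: mono_eval_def hom)
  have keys: "Poly_Mapping.keys m \<subseteq> V" if "m \<in> Poly_Mapping.keys Q" for m
    using Q that by (auto simp: polys_in_def)
  show ?thesis
  proof (rule coeffs_in_subgroup[where G = ?G and M = "Poly_Mapping.keys Q", OF _ _ _ _ A _ True])
    show "lead_coeff (?G m) = 1" if "m \<in> Poly_Mapping.keys Q" for m
      using keys[OF that] unfolding G lead_coeff_prod
      by (intro prod.neutral) (auto simp: lead_coeff_power monic)
    have "degree (?G m) = (\<Sum>v\<in>Poly_Mapping.keys m. Poly_Mapping.lookup m v * D v)"
      if "m \<in> Poly_Mapping.keys Q" for m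
    proof -
      have nz: "kronecker d (to_rat (f v)) \<noteq> 0" if "v \<in> Poly_Mapping.keys m" for v
        using monic[of v] keys[OF \<open>m \<in> _\<close>] that by auto
      then show ?thesis
        using keys[OF that] unfolding G
        by (subst degree_prod_eq_sum_degree)
          (auto simp: degree_power_eq nz deg subset_iff intro!: sum.cong)
    qed
    then show "inj_on (\<lambda>m. degree (?G m)) (Poly_Mapping.keys Q)"
      using inj by (simp cong: inj_on_cong)
    show "coeff (?G m) k \<in> \<int>" for m k
      by (intro coeff_kronecker_in) (auto simp: lookup_to_rat)
    fix k
    have "kronecker d (msubst (\<lambda>v. to_rat (f v)) Q)
        = (\<Sum>m\<in>Poly_Mapping.keys Q. [:Poly_Mapping.lookup Q m:] * ?G m)"
      unfolding msubst_def G
      by (simp add: hom) (simp add: kronecker_def peval_mconst is_ring_hom_pCons)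
    then have "(\<Sum>m\<in>Poly_Mapping.keys Q. Poly_Mapping.lookup Q m * coeff (?G m) k)
        = coeff (kronecker d (msubst (\<lambda>v. to_rat (f v)) Q)) k"
      by (simp add: coeff_sum)
    also have "\<dots> \<in> A"
      by (rule coeff_kronecker_in[OF A(1,2) QA])
    finally show "(\<Sum>m\<in>Poly_Mapping.keys Q. Poly_Mapping.lookup Q m * coeff (?G m) k) \<in> A" .
  qed simp
qed

section \<open>Digit expansions and leading monomials\<close>

text \<open>At the lowest place where the expansions differ, all other differing terms are divisible
  by the next power of \<open>B\<close>. Hence \<open>B\<close> divides a nonzero difference of two
  digits below \<open>B\<close>.\<close>

lemma digits_unique:
  fixes a b :: "'w \<Rightarrow> nat"
  assumes fin: "finite W" and inj: "inj_on \<rho> W"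
    and a: "\<And>w. w \<in> W \<Longrightarrow> a w < B" and b: "\<And>w. w \<in> W \<Longrightarrow> b w < B"
    and eq: "(\<Sum>w\<in>W. a w * B ^ \<rho> w) = (\<Sum>w\<in>W. b w * B ^ \<rho> w)"
    and w: "w \<in> W"
  shows "a w = b w"
proof (rule ccontr)
  assume "a w \<noteq> b w"
  define N where "N = {w \<in> W. a w \<noteq> b w}"
  have N: "finite N" "N \<noteq> {}"
    using fin w \<open>a w \<noteq> b w\<close> by (auto simp: N_def)
  then have "Min (\<rho> ` N) \<in> \<rho> ` N"
    by (intro Min_in) auto
  then obtain x where x: "x \<in> N" and x_min: "\<rho> x = Min (\<rho> ` N)"
    by auto
  have min: "\<rho> x \<le> \<rho> y" if "y \<in> N" for y
    unfolding x_min using that N by (intro Min_le) auto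
  let ?c = "\<lambda>w. (int (a w) - int (b w)) * int B ^ \<rho> w"
  have "int (\<Sum>w\<in>W. a w * B ^ \<rho> w) = int (\<Sum>w\<in>W. b w * B ^ \<rho> w)"
    using eq by simp
  then have "(\<Sum>w\<in>W. ?c w) = 0"
    by (simp add: algebra_simps sum_subtractf)
  moreover have "(\<Sum>w\<in>W. ?c w) = (\<Sum>w\<in>N. ?c w)"
    using fin by (intro sum.mono_neutral_right) (auto simp: N_def)
  moreover have "(\<Sum>w\<in>N. ?c w) = ?c x + (\<Sum>w\<in>N - {x}. ?c w)"
    using N x by (intro sum.remove) auto
  moreover have "int B ^ Suc (\<rho> x) dvd (\<Sum>w\<in>N - {x}. ?c w)"
  proof (intro dvd_sum dvd_mult)
    fix y assume y: "y \<in> N - {x}"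
    then have "\<rho> x \<noteq> \<rho> y"
      using inj x by (auto simp: N_def inj_on_def)
    then have "Suc (\<rho> x) \<le> \<rho> y"
      using min[of y] y by auto
    then show "int B ^ Suc (\<rho> x) dvd int B ^ \<rho> y"
      by (rule le_imp_power_dvd)
  qed
  ultimately have "int B ^ Suc (\<rho> x) dvd ?c x"
    using dvd_add_left_iff[of "int B ^ Suc (\<rho> x)" "\<Sum>w\<in>N - {x}. ?c w" "?c x"] by simp
  moreover have "x \<in> W" "a x \<noteq> b x"
    using x by (auto simp: N_def)
  moreover have "B \<noteq> 0"
    using a[OF \<open>x \<in> W\<close>] by auto
  ultimately have "int B dvd int (a x) - int (b x)"
    by (simp add: mult.commute)
  then have "\<bar>int B\<bar> \<le> \<bar>int (a x) - int (b x)\<bar>"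
    using \<open>a x \<noteq> b x\<close> by (intro dvd_imp_le_int) auto
  then show False
    using a[OF \<open>x \<in> W\<close>] b[OF \<open>x \<in> W\<close>] by linarith
qed

text \<open>As every variable in \<open>T\<close> outweighs every variable outside, \<open>T\<close>
  is the only subset of its size with maximal weight, and its term leads.\<close>

lemma kronecker_esym:
  assumes fin: "finite V" and T: "T \<subseteq> V"
    and less: "\<And>a b. a \<in> V - T \<Longrightarrow> b \<in> T \<Longrightarrow> d a < d b"
  shows "degree (kronecker d (to_rat (esym V (card T)))) = (\<Sum>w\<in>T. d w)"
    and "lead_coeff (kronecker d (to_rat (esym V (card T)))) = 1"
proof -
  let ?C = "{S. S \<subseteq> V \<and> card S = card T}"
  let ?q = "\<Sum>S\<in>?C - {T}. monom (1 :: rat) (sum d S)"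
  have finC: "finite ?C"
    using fin by simp
  have "kronecker d (mvar v) = monom 1 (d v)" for v
    by (simp add: kronecker_def peval_mvar is_ring_hom_pCons)
  moreover have "(\<Prod>w\<in>S. monom 1 (d w)) = monom (1 :: rat) (sum d S)" for S
    by (induction S rule: infinite_finite_induct) (simp_all add: mult_monom)
  ultimately have "kronecker d (to_rat (esym V (card T))) = (\<Sum>S\<in>?C. monom 1 (sum d S))"
    by (simp add: esym_def hom_simps[OF is_ring_hom_kronecker])
  also have "\<dots> = monom 1 (sum d T) + ?q"
    using finC T by (intro sum.remove) auto
  finally have eq: "kronecker d (to_rat (esym V (card T))) = monom 1 (sum d T) + ?q" .
  have lt: "sum d S < sum d T" if S: "S \<in> ?C - {T}" for S
  proof -
    have finS: "finite S" "finite T"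
      using S T fin by (auto intro: finite_subset)
    have "card (S - T) = card (T - S)"
      using S finS by (simp add: card_Diff_subset_Int Int_commute)
    moreover have "S \<noteq> T" "card S = card T"
      using S by auto
    then have ne: "T - S \<noteq> {}"
      using finS card_subset_eq[of S T] by auto
    \<comment> \<open>Exchanging the elements of \<open>S - T\<close> for those of
      \<open>T - S\<close> along a bijection raises the weight at every element.\<close>
    ultimately obtain f where f: "bij_betw f (S - T) (T - S)"
      using finS bij_betw_iff_card[of "S - T" "T - S"] by auto
    have "sum d (S - T) < (\<Sum>x\<in>S - T. d (f x))"
    proof (rule sum_strict_mono)
      show "S - T \<noteq> {}"
        using ne f by (auto simp: bij_betw_def)
      show "d x < d (f x)" if "x \<in> S - T" for x
        using that f S by (intro less) (auto simp: bij_betw_def)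
    qed (use finS in auto)
    also have "\<dots> = sum d (T - S)"
      using f by (rule sum.reindex_bij_betw)
    finally have "sum d (S - T) < sum d (T - S)" .
    moreover have "sum d S = sum d (S \<inter> T) + sum d (S - T)"
      using finS(1) by (rule sum.Int_Diff)
    moreover have "sum d T = sum d (S \<inter> T) + sum d (T - S)"
      unfolding Int_commute[of S T] using finS(2) by (rule sum.Int_Diff)
    ultimately show ?thesis by linarith
  qed
  have "coeff ?q k = 0" if "k \<ge> sum d T" for k
    unfolding coeff_sum
  proof (intro sum.neutral ballI)
    fix S assume "S \<in> ?C - {T}"
    then have "sum d S \<noteq> k"
      using lt[of S] that by linarith
    then show "coeff (monom 1 (sum d S)) k = 0"
      by simp
  qed
  then have c: "coeff (monom 1 (sum d T) + ?q) k = (if k = sum d T then 1 else 0)"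
    if "k \<ge> sum d T" for k
    using that by simp
  show deg: "degree (kronecker d (to_rat (esym V (card T)))) = sum d T"
    unfolding eq by (rule antisym[OF degree_le le_degree]) (simp_all add: c del: coeff_add)
  show "lead_coeff (kronecker d (to_rat (esym V (card T)))) = 1"
    unfolding deg unfolding eq by (simp add: c del: coeff_add)
qed

text \<open>
  Variables \<open>v \<in> V\<close> are split into blocks \<open>B v\<close>; \<open>\<rho>\<close> ranks the variables, and \<open>T v\<close> is the set of
  variables of the leading monomial of the elementary symmetric polynomial substituted for \<open>v\<close>.
\<close>

locale symmetric_blocks =
  fixes V :: "'v set" and B T :: "'v \<Rightarrow> 'v set" and \<rho> :: "'v \<Rightarrow> nat"
    and f :: "'v \<Rightarrow> ('v, int) mpoly"
  assumes finite_V: "finite V" and inj: "inj_on \<rho> V"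
    and T_subset: "v \<in> V \<Longrightarrow> T v \<subseteq> B v" and B_subset: "v \<in> V \<Longrightarrow> B v \<subseteq> V"
    and self_in_T: "v \<in> V \<Longrightarrow> v \<in> T v"
    and T_less: "v \<in> V \<Longrightarrow> w \<in> T v \<Longrightarrow> w \<noteq> v \<Longrightarrow> \<rho> v < \<rho> w"
    and B_less: "v \<in> V \<Longrightarrow> a \<in> B v - T v \<Longrightarrow> b \<in> T v \<Longrightarrow> \<rho> a < \<rho> b"
    and f_eq: "v \<in> V \<Longrightarrow> f v = esym (B v) (card (T v))"
begin

text \<open>Regrouped by rank, the weight is a base \<open>b\<close> expansion whose digit at
  \<open>w\<close> sums the exponents of all \<open>v\<close> with \<open>w \<in> T v\<close>. The
  digits are thus determined, and the exponents follow by solving a triangular system.\<close>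

lemma weight_unique:
  fixes m m' :: "'v \<Rightarrow>\<^sub>0 nat"
  assumes keys: "Poly_Mapping.keys m \<subseteq> V" "Poly_Mapping.keys m' \<subseteq> V"
    and less: "(\<Sum>v\<in>V. Poly_Mapping.lookup m v) < b" "(\<Sum>v\<in>V. Poly_Mapping.lookup m' v) < b"
    and eq: "(\<Sum>v\<in>V. Poly_Mapping.lookup m v * (\<Sum>w\<in>T v. b ^ \<rho> w))
      = (\<Sum>v\<in>V. Poly_Mapping.lookup m' v * (\<Sum>w\<in>T v. b ^ \<rho> w))"
  shows "m = m'"
proof -
  let ?U = "\<lambda>w. {v \<in> V. w \<in> T v}"
  have swap: "(\<Sum>v\<in>V. l v * (\<Sum>w\<in>T v. b ^ \<rho> w)) = (\<Sum>w\<in>V. (\<Sum>v\<in>?U w. l v) * b ^ \<rho> w)" for l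
  proof -
    have "(\<Sum>v\<in>V. l v * (\<Sum>w\<in>T v. b ^ \<rho> w)) = (\<Sum>v\<in>V. \<Sum>w\<in>{w \<in> V. w \<in> T v}. l v * b ^ \<rho> w)"
      using T_subset B_subset unfolding sum_distrib_left
      by (intro sum.cong refl) blast
    also have "\<dots> = (\<Sum>w\<in>V. \<Sum>v\<in>?U w. l v * b ^ \<rho> w)"
      by (rule sum.swap_restrict[OF finite_V finite_V])
    finally show ?thesis by (simp add: sum_distrib_right)
  qed
  have small: "(\<Sum>v\<in>?U w. l v) < b" if "(\<Sum>v\<in>V. l v) < b" for l :: "'v \<Rightarrow> nat" and w
    using that sum_mono2[OF finite_V, of "?U w" l] by simp
  have digits: "(\<Sum>v\<in>?U w. Poly_Mapping.lookup m v) = (\<Sum>v\<in>?U w. Poly_Mapping.lookup m' v)"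
    if "w \<in> V" for w
    by (rule digits_unique[OF finite_V inj small[OF less(1)] small[OF less(2)] _ that])
      (use eq swap in simp)
  have "Poly_Mapping.lookup m w = Poly_Mapping.lookup m' w" if "w \<in> V" for w
    using that
  proof (induction "\<rho> w" arbitrary: w rule: less_induct)
    case less
    \<comment> \<open>By \<open>T_less\<close>, the digit at \<open>w\<close> involves, besides
      \<open>w\<close> itself, only variables of smaller rank.\<close>
    have U: "?U w = insert w (?U w - {w})"
      using less.prems self_in_T by auto
    have "(\<Sum>v\<in>?U w - {w}. Poly_Mapping.lookup m v) = (\<Sum>v\<in>?U w - {w}. Poly_Mapping.lookup m' v)"
      using T_less by (intro sum.cong refl less.hyps) auto
    moreover have "(\<Sum>v\<in>?U w. l v) = l w + (\<Sum>v\<in>?U w - {w}. l v)" for l :: "'v \<Rightarrow> nat"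
      using finite_V less.prems self_in_T by (intro sum.remove) auto
    ultimately show ?case
      using digits[OF less.prems] by simp
  qed
  moreover have "Poly_Mapping.lookup m w = Poly_Mapping.lookup m' w" if "w \<notin> V" for w
    using that keys by (metis in_keys_iff subsetD)
  ultimately show ?thesis
    by (intro poly_mapping_eqI) blast
qed

lemma in_subgroup:
  fixes Q :: "('v, rat) mpoly"
  assumes Q: "Q \<in> polys_in V"
    and A: "0 \<in> A" "\<And>a b. a \<in> A \<Longrightarrow> b \<in> A \<Longrightarrow> a + b \<in> A" "\<And>a k. a \<in> A \<Longrightarrow> of_int k * a \<in> A"
    and QA: "\<And>m. Poly_Mapping.lookup (msubst (\<lambda>v. to_rat (f v)) Q) m \<in> A"
  shows "Poly_Mapping.lookup Q m \<in> A"
proof -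
  \<comment> \<open>The base exceeds the total degree of every monomial of \<open>Q\<close>, so no
    digit overflows; the summand 2 makes \<open>b ^ \<rho> w\<close> strictly increasing in the
    rank.\<close>
  define b where "b = 2 + (\<Sum>m\<in>Poly_Mapping.keys Q. \<Sum>v\<in>V. Poly_Mapping.lookup m v)"
  define d where "d w = b ^ \<rho> w" for w
  have "b \<ge> 2"
    by (simp add: b_def)
  then have d_less: "d x < d y \<longleftrightarrow> \<rho> x < \<rho> y" for x y
    by (simp add: d_def)
  have less: "(\<Sum>v\<in>V. Poly_Mapping.lookup m v) < b" if "m \<in> Poly_Mapping.keys Q" for m
    using member_le_sum[OF that, of "\<lambda>m. \<Sum>v\<in>V. Poly_Mapping.lookup m v"] by (simp add: b_def)
  have keys: "Poly_Mapping.keys m \<subseteq> V" if "m \<in> Poly_Mapping.keys Q" for m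
    using Q that by (auto simp: polys_in_def)
  have sums: "(\<Sum>v\<in>Poly_Mapping.keys m. Poly_Mapping.lookup m v * D v)
      = (\<Sum>v\<in>V. Poly_Mapping.lookup m v * D v)" if "m \<in> Poly_Mapping.keys Q" for m and D :: "'v \<Rightarrow> nat"
    using keys[OF that] by (intro sum.mono_neutral_left finite_V) (auto simp: in_keys_iff)
  have fin: "finite (B v)" if "v \<in> V" for v
    using B_subset[OF that] finite_V by (rule finite_subset)
  show ?thesis
  proof (rule kronecker_in_subgroup[where f = f and d = d and D = "\<lambda>v. \<Sum>w\<in>T v. d w", OF Q _ _ _ A QA])
    show "inj_on (\<lambda>m. \<Sum>v\<in>Poly_Mapping.keys m. Poly_Mapping.lookup m v * (\<Sum>w\<in>T v. d w))
        (Poly_Mapping.keys Q)"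
      by (rule inj_onI, rule weight_unique[where b = b])
        (simp_all add: keys less sums flip: d_def)
    show "degree (kronecker d (to_rat (f v))) = (\<Sum>w\<in>T v. d w)"
      "lead_coeff (kronecker d (to_rat (f v))) = 1" if "v \<in> V" for v
      unfolding f_eq[OF that]
      by (rule kronecker_esym; use that fin T_subset B_less d_less in auto)+
  qed
qed

text \<open>Algebraic independence of the \<open>f v\<close>, obtained from
  \<open>in_subgroup\<close> with the zero subgroup.\<close>

lemma msubst_inject:
  assumes "P \<in> polys_in V" "P' \<in> polys_in V" "msubst f P = msubst f P'"
  shows "P = P'"
proof -
  have zero: "msubst (\<lambda>v. to_rat (f v)) (to_rat (P - P')) = 0"
    using assms(3) by (simp flip: to_rat_msubst)
  have "Poly_Mapping.lookup (to_rat (P - P')) m \<in> {0}" for m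
    by (rule in_subgroup) (use assms zero in \<open>auto simp: to_rat_in_polys_in_iff polys_in_diff
      simp del: to_rat_simps\<close>)
  then show ?thesis
    by (simp add: lookup_to_rat lookup_minus poly_mapping_eq_iff fun_eq_iff del: to_rat_simps)
qed

text \<open>Here \<open>in_subgroup\<close> is used with the subgroup of integers: a rational
  polynomial with integral image has integer coefficients.\<close>

lemma exists_integral:
  assumes Q: "Q \<in> polys_in V" "msubst (\<lambda>v. to_rat (f v)) Q = to_rat Z"
  obtains P where "P \<in> polys_in V" "to_rat P = Q" "msubst f P = Z"
proof
  \<comment> \<open>Rounding leaves the coefficients unchanged, as they are integers, and merely
    changes their type.\<close>
  define P where "P = Poly_Mapping.map floor Q"
  have "Poly_Mapping.lookup Q m \<in> \<int>" for m
    by (rule in_subgroup[OF Q(1)]) (auto simp: Q(2) lookup_to_rat)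
  then have "of_int \<lfloor>Poly_Mapping.lookup Q m\<rfloor> = Poly_Mapping.lookup Q m" for m
    by (metis Ints_cases floor_of_int)
  moreover have "Poly_Mapping.lookup P m = \<lfloor>Poly_Mapping.lookup Q m\<rfloor>" for m
    unfolding P_def by transfer (auto simp: when_def)
  ultimately show *: "to_rat P = Q"
    by (intro poly_mapping_eqI) (simp add: lookup_to_rat)
  show "P \<in> polys_in V"
    using Q(1) by (simp add: to_rat_in_polys_in_iff flip: *)
  have "to_rat (msubst f P) = to_rat Z"
    by (simp add: to_rat_msubst * Q(2))
  then show "msubst f P = Z"
    by (simp add: to_rat_inject)
qed

lemma the_eq:
  assumes "P \<in> polys_in V" "msubst f P = Z"
  shows "(THE P. P \<in> polys_in V \<and> msubst f P = Z) = P"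
  using assms msubst_inject by (intro the_equality) auto

end


section \<open>The universal polynomials over the rationals\<close>

text \<open>The k-th elementary symmetric polynomial has leading variables 1 to k, so ranks must
  decrease with the index.\<close>

lemma symmetric_blocks_single:
  "symmetric_blocks {1..n} (\<lambda>_. {1..n}) (\<lambda>k. {1..k}) (\<lambda>k. n - k) (esym {1..n})"
  by unfold_locales (auto simp: inj_on_def)

text \<open>The ranks of the left block lie below \<open>n\<close> and those of the right block
  start at \<open>n\<close>, which keeps them distinct.\<close>

lemma symmetric_blocks_double:
  "symmetric_blocks (Inl ` {1..n} \<union> Inr ` {1..n})
     (case_sum (\<lambda>_. Inl ` {1..n}) (\<lambda>_. Inr ` {1..n}))
     (case_sum (\<lambda>k. Inl ` {1..k}) (\<lambda>k. Inr ` {1..k}))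
     (case_sum (\<lambda>k. n - k) (\<lambda>k. 2 * n - k))
     (case_sum (esym (Inl ` {1..n})) (esym (Inr ` {1..n})))"
  by (unfold_locales; auto simp: inj_on_def card_image image_iff; arith)

text \<open>Newton's identities give existence for every number of variables; uniqueness already
  follows from the case of \<open>n\<close> variables.\<close>

lemma N_poly_eq:
  assumes n: "n \<ge> 1"
  shows "N_poly n = newton_poly n"
proof -
  let ?p = "\<lambda>m. \<Sum>i\<in>{1..m}. mvar i ^ n :: (nat, int) mpoly"
  have "msubst (esym {1..m}) (newton_poly n) = ?p m" for m
    unfolding msubst_eq_peval
    by (rule newton_imp_newton_poly[OF is_ring_hom_mconst newton_esym n, symmetric]) simp
  moreover have "N = newton_poly n"
    if "N \<in> polys_in {1..n} \<and> (\<forall>m. msubst (esym {1..m}) N = ?p m)" for N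
    using symmetric_blocks.msubst_inject[OF symmetric_blocks_single _ newton_poly_in] that calculation
    by metis
  ultimately show ?thesis
    unfolding N_poly_def using newton_poly_in by (intro the_equality) blast+
qed

lemma N_poly_in: "n \<ge> 1 \<Longrightarrow> N_poly n \<in> polys_in {1..n}"
  by (simp add: N_poly_eq newton_poly_in del: One_nat_def)

lemma newton_to_rat_esym:
  assumes "finite V"
  shows "newton (\<lambda>k. to_rat (esym V k)) (\<lambda>n. \<Sum>v\<in>V. mvar v ^ n)"
  using newton_hom[OF is_ring_hom_to_rat newton_esym[OF assms]] by simp

lemma msubst_newton_poly_esym:
  assumes "finite V" "n \<ge> 1"
  shows "msubst (\<lambda>k. to_rat (esym V k)) (to_rat (newton_poly n)) = (\<Sum>v\<in>V. mvar v ^ n)"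
  unfolding msubst_to_rat
  by (rule newton_imp_newton_poly[OF is_ring_hom_mconst_of_int newton_to_rat_esym[OF assms(1)]
        assms(2), symmetric])

text \<open>Over the rationals, elementary symmetric functions of arbitrary elements
  \<open>x a\<close> are recovered from their power sums by \<open>L_poly\<close>.\<close>

lemma to_rat_coeff_prod_linear:
  fixes x :: "'a \<Rightarrow> ('v, int) mpoly"
  assumes "finite A"
  shows "to_rat (coeff (\<Prod>a\<in>A. [:1, x a:]) n) = msubst (\<lambda>i. \<Sum>a\<in>A. to_rat (x a) ^ i) (L_poly n)"
  using newton_imp_L_poly[OF newton_hom[OF is_ring_hom_to_rat newton_prod_linear[OF assms]]]
  by simp

text \<open>Over the rationals, \<open>P\<^sub>n\<close> expresses that the power sums of the products
  \<open>X\<^sub>i Y\<^sub>j\<close> are the products of the power sums of the \<open>X\<^sub>i\<close> and of the \<open>Y\<^sub>j\<close>.\<close>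

lemma P_poly_characterization:
  "P_poly n \<in> polys_in (Inl ` {1..n} \<union> Inr ` {1..n})" (is ?in)
  "to_rat (P_poly n) = msubst (\<lambda>i. msubst (\<lambda>k. mvar (Inl k)) (to_rat (newton_poly i)) *
     msubst (\<lambda>k. mvar (Inr k)) (to_rat (newton_poly i))) (L_poly n)" (is "_ = ?Q")
proof -
  let ?V = "Inl ` {1..n} \<union> Inr ` {1..n} :: (nat + nat) set"
  let ?X = "Inl ` {1..n} :: (nat + nat) set"
  let ?Y = "Inr ` {1..n} :: (nat + nat) set"
  let ?f = "case_sum (esym ?X) (esym ?Y)"
  let ?Z = "coeff (\<Prod>i\<in>{1..n}. \<Prod>j\<in>{1..n}. [:1, mvar (Inl i) * mvar (Inr j):] ::
         (nat + nat, int) mpoly poly) n"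
  interpret symmetric_blocks ?V "case_sum (\<lambda>_. ?X) (\<lambda>_. ?Y)"
     "case_sum (\<lambda>k. Inl ` {1..k}) (\<lambda>k. Inr ` {1..k})" "case_sum (\<lambda>k. n - k) (\<lambda>k. 2 * n - k)" ?f
    by (rule symmetric_blocks_double)
  have in_V: "msubst (\<lambda>k. mvar (Inl k)) (to_rat (newton_poly i)) \<in> polys_in ?V"
    "msubst (\<lambda>k. mvar (Inr k)) (to_rat (newton_poly i)) \<in> polys_in ?V" if "i \<in> {1..n}" for i
    by (rule polys_in_msubst[where V = "{1..i}"],
        simp add: to_rat_in_polys_in_iff newton_poly_in del: One_nat_def,
        use that in \<open>auto intro!: polys_in_mvar\<close>)+
  then have Q_in: "?Q \<in> polys_in ?V"
    by (intro polys_in_msubst[OF L_poly_in] polys_in_mult)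
  have "msubst (\<lambda>v. to_rat (?f v)) ?Q = msubst (\<lambda>i.
      msubst (\<lambda>k. to_rat (esym ?X k)) (to_rat (newton_poly i)) *
      msubst (\<lambda>k. to_rat (esym ?Y k)) (to_rat (newton_poly i))) (L_poly n)"
    by (simp add: msubst_msubst)
  also have "\<dots> = msubst (\<lambda>i. (\<Sum>v\<in>?X. mvar v ^ i) * (\<Sum>v\<in>?Y. mvar v ^ i)) (L_poly n)"
    by (rule msubst_cong[OF L_poly_in]) (simp add: msubst_newton_poly_esym)
  also have "\<dots> = msubst (\<lambda>i. \<Sum>a\<in>{1..n} \<times> {1..n}.
      to_rat (mvar (Inl (fst a)) * mvar (Inr (snd a))) ^ i) (L_poly n)"
    by (simp add: sum_product sum.cartesian_product sum.reindex power_mult_distrib case_prod_beta)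
  also have "\<dots> = to_rat (coeff (\<Prod>a\<in>{1..n} \<times> {1..n}. [:1, mvar (Inl (fst a)) * mvar (Inr (snd a)):]) n)"
    by (rule to_rat_coeff_prod_linear[symmetric]) simp
  also have "(\<Prod>a\<in>{1..n} \<times> {1..n}. [:1, mvar (Inl (fst a)) * mvar (Inr (snd a)) :: (nat + nat, int) mpoly:])
      = (\<Prod>i\<in>{1..n}. \<Prod>j\<in>{1..n}. [:1, mvar (Inl i) * mvar (Inr j):])"
    by (simp add: prod.cartesian_product case_prod_beta)
  \<comment> \<open>\<open>?Q\<close> is rational a priori, but substituting elementary symmetric
    polynomials gives the integral \<open>?Z\<close>.\<close>
  finally obtain P where P: "P \<in> polys_in ?V" "to_rat P = ?Q" "msubst ?f P = ?Z"
    using exists_integral[OF Q_in] by blast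
  have "P_poly n = P"
    unfolding P_poly_def by (rule the_eq[OF P(1,3)])
  then show ?in "to_rat (P_poly n) = ?Q"
    using P by simp_all
qed

text \<open>The i-th power sum of the m-fold products of variables is the m-th elementary symmetric
  function of the i-th powers, and the j-th power sum of those powers is the power sum of index
  \<open>i * j\<close>.\<close>

lemma P_comp_poly_characterization:
  "P_comp_poly n m \<in> polys_in {1..n * m}" (is ?in)
  "to_rat (P_comp_poly n m) =
     msubst (\<lambda>i. msubst (\<lambda>j. to_rat (newton_poly (i * j))) (L_poly m)) (L_poly n)" (is "_ = ?Q")
proof -
  let ?V = "{1..n * m}"
  let ?f = "esym ?V"
  let ?S = "{S. S \<subseteq> ?V \<and> card S = m}"
  let ?Z = "coeff (\<Prod>S | S \<subseteq> ?V \<and> card S = m. [:1, \<Prod>j\<in>S. mvar j:] :: (nat, int) mpoly poly) n"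
  interpret symmetric_blocks ?V "\<lambda>_. ?V" "\<lambda>k. {1..k}" "\<lambda>k. n * m - k" ?f
    by (rule symmetric_blocks_single)
  have in_V: "to_rat (newton_poly (i * j)) \<in> polys_in ?V" if "i \<in> {1..n}" "j \<in> {1..m}" for i j
  proof -
    have "i * j \<le> n * m"
      using that by (intro mult_le_mono) auto
    then show ?thesis
      using polys_in_mono[OF newton_poly_in, of "i * j" ?V] by (auto simp: to_rat_in_polys_in_iff)
  qed
  then have Q_in: "?Q \<in> polys_in ?V"
    by (intro polys_in_msubst[OF L_poly_in])
  have "msubst (\<lambda>v. to_rat (?f v)) ?Q = msubst (\<lambda>i. msubst (\<lambda>j.
      msubst (\<lambda>v. to_rat (?f v)) (to_rat (newton_poly (i * j)))) (L_poly m)) (L_poly n)"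
    by (simp add: msubst_msubst)
  also have "\<dots> = msubst (\<lambda>i. msubst (\<lambda>j. \<Sum>v\<in>?V. to_rat (mvar v ^ i) ^ j) (L_poly m)) (L_poly n)"
    by (intro msubst_cong[OF L_poly_in]) (simp add: msubst_newton_poly_esym power_mult)
  also have "\<dots> = msubst (\<lambda>i. to_rat (coeff (\<Prod>v\<in>?V. [:1, mvar v ^ i:]) m)) (L_poly n)"
    by (simp only: to_rat_coeff_prod_linear[OF finite_atLeastAtMost])
  also have "\<dots> = msubst (\<lambda>i. \<Sum>S\<in>?S. to_rat (\<Prod>v\<in>S. mvar v) ^ i) (L_poly n)"
    by (simp only: coeff_prod_linear[OF finite_atLeastAtMost])
      (simp add: prod_power_distrib)
  also have "\<dots> = to_rat ?Z"
    by (rule to_rat_coeff_prod_linear[symmetric]) simp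
  finally obtain P where P: "P \<in> polys_in ?V" "to_rat P = ?Q" "msubst ?f P = ?Z"
    using exists_integral[OF Q_in] by blast
  have "P_comp_poly n m = P"
    unfolding P_comp_poly_def by (rule the_eq[OF P(1,3)])
  then show ?in "to_rat (P_comp_poly n m) = ?Q"
    using P by simp_all
qed


section \<open>Evaluation in a ring with carrier\<close>

context cring
begin

definition meval_mono :: "('v \<Rightarrow> 'a) \<Rightarrow> ('v \<Rightarrow>\<^sub>0 nat) \<Rightarrow> 'a" where
  "meval_mono f m = (\<Otimes>v\<in>Poly_Mapping.keys m. f v [^] Poly_Mapping.lookup m v)"

context
  fixes f :: "'v \<Rightarrow> 'a"
  assumes f: "f v \<in> carrier R"
begin

lemma meval_mono_closed [simp]: "meval_mono f m \<in> carrier R"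
  by (auto simp: meval_mono_def f intro!: finprod_closed)

lemma meval_mono_superset:
  assumes "finite S" "Poly_Mapping.keys m \<subseteq> S"
  shows "meval_mono f m = (\<Otimes>v\<in>S. f v [^] Poly_Mapping.lookup m v)"
  unfolding meval_mono_def
  by (rule finprod_mono_neutral_cong_left[OF assms]) (auto simp: f in_keys_iff)

lemma meval_mono_add: "meval_mono f (m + m') = meval_mono f m \<otimes> meval_mono f m'"
proof -
  let ?S = "Poly_Mapping.keys m \<union> Poly_Mapping.keys m'"
  have "meval_mono f (m + m') = (\<Otimes>v\<in>?S. f v [^] Poly_Mapping.lookup (m + m') v)"
    using keys_add[of m m'] by (intro meval_mono_superset) auto
  also have "\<dots> = (\<Otimes>v\<in>?S. f v [^] Poly_Mapping.lookup m v \<otimes> f v [^] Poly_Mapping.lookup m' v)"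
    by (intro finprod_cong) (simp_all add: f lookup_add nat_pow_mult simp_implies_def)
  also have "\<dots> = (\<Otimes>v\<in>?S. f v [^] Poly_Mapping.lookup m v) \<otimes> (\<Otimes>v\<in>?S. f v [^] Poly_Mapping.lookup m' v)"
    by (intro finprod_multf) (simp_all add: f)
  also have "\<dots> = meval_mono f m \<otimes> meval_mono f m'"
    by (simp add: meval_mono_superset[of ?S])
  finally show ?thesis .
qed

lemma meval_eq: "meval R f p =
    (\<Oplus>m\<in>Poly_Mapping.keys p. [Poly_Mapping.lookup p m] \<cdot> meval_mono f m)"
  by (simp add: meval_def meval_mono_def)

lemma meval_closed [simp]: "meval R f p \<in> carrier R"
  by (simp add: meval_eq)

lemma meval_superset:
  assumes "finite S" "Poly_Mapping.keys p \<subseteq> S"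
  shows "meval R f p = (\<Oplus>m\<in>S. [Poly_Mapping.lookup p m] \<cdot> meval_mono f m)"
  unfolding meval_eq
  by (rule add.finprod_mono_neutral_cong_left[OF assms]) (auto simp: in_keys_iff add_pow_int_ge)

lemma meval_0: "meval R f 0 = \<zero>"
  by (simp add: meval_eq)

lemma meval_single: "meval R f (Poly_Mapping.single m c) = [c] \<cdot> meval_mono f m"
  by (subst meval_superset[where S = "{m}"]) simp_all

lemma meval_add: "meval R f (p + q) = meval R f p \<oplus> meval R f q"
proof -
  \<comment> \<open>Monomials may cancel in \<open>p + q\<close>, so all three sums are taken over
    the union of the supports.\<close>
  let ?S = "Poly_Mapping.keys p \<union> Poly_Mapping.keys q"
  have "meval R f (p + q) = (\<Oplus>m\<in>?S. [Poly_Mapping.lookup (p + q) m] \<cdot> meval_mono f m)"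
    using keys_add[of p q] by (intro meval_superset) auto
  also have "\<dots> = (\<Oplus>m\<in>?S. [Poly_Mapping.lookup p m] \<cdot> meval_mono f m
      \<oplus> [Poly_Mapping.lookup q m] \<cdot> meval_mono f m)"
    by (intro add.finprod_cong) (simp_all add: lookup_add add.int_pow_mult simp_implies_def)
  also have "\<dots> = (\<Oplus>m\<in>?S. [Poly_Mapping.lookup p m] \<cdot> meval_mono f m)
      \<oplus> (\<Oplus>m\<in>?S. [Poly_Mapping.lookup q m] \<cdot> meval_mono f m)"
    by (intro add.finprod_multf) simp_all
  also have "\<dots> = meval R f p \<oplus> meval R f q"
    by (simp add: meval_superset[of ?S])
  finally show ?thesis .
qed

lemma meval_mult: "meval R f (p * q) = meval R f p \<otimes> meval R f q"
proof -
  have single_single: "meval R f (Poly_Mapping.single m c * Poly_Mapping.single m' c')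
      = meval R f (Poly_Mapping.single m c) \<otimes> meval R f (Poly_Mapping.single m' c')" for m c m' c'
    by (simp add: mult_single meval_single meval_mono_add add_pow_ldistr_int add_pow_rdistr_int
      add.int_pow_pow mult.commute m_comm)
  have single: "meval R f (Poly_Mapping.single m c * q)
      = meval R f (Poly_Mapping.single m c) \<otimes> meval R f q" for m c
    by (rule poly_mapping_single_induct[where M = UNIV and p = q and P = "\<lambda>q.
          meval R f (Poly_Mapping.single m c * q) = meval R f (Poly_Mapping.single m c) \<otimes> meval R f q"])
      (simp_all add: single_single meval_add meval_0 distrib_left r_distr)
  show ?thesis
    by (rule poly_mapping_single_induct[where M = UNIV and p = p])
      (simp_all add: single meval_add meval_0 distrib_right l_distr)
qed

lemma meval_mconst: "meval R f (mconst c) = [c] \<cdot> \<one>"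
  by (simp add: mconst_def meval_single) (simp add: meval_mono_def)

lemma meval_mvar: "meval R f (mvar v) = f v"
  by (simp add: mvar_def meval_single) (simp add: meval_mono_def f)

lemma meval_1: "meval R f 1 = \<one>"
  using meval_mconst[of 1] by simp

lemma meval_uminus: "meval R f (- p) = \<ominus> meval R f p"
proof -
  have "meval R f (- p) \<oplus> meval R f p = \<zero>"
    by (simp add: meval_0 flip: meval_add)
  then show ?thesis
    by (simp add: minus_equality)
qed

lemma meval_sum: "meval R f (sum p A) = (\<Oplus>a\<in>A. meval R f (p a))"
  by (induction A rule: infinite_finite_induct) (simp_all add: meval_0 meval_add)

lemma meval_power: "meval R f (p ^ k) = meval R f p [^] k"
  by (induction k) (simp_all add: meval_1 meval_mult m_comm)

end

lemma meval_cong: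
  assumes "p \<in> polys_in V" "\<And>v. v \<in> V \<Longrightarrow> f v = g v" "\<And>v. g v \<in> carrier R"
  shows "meval R f p = meval R g p"
  unfolding meval_def
proof (intro finsum_cong' refl)
  fix m assume m: "m \<in> Poly_Mapping.keys p"
  have "(\<Otimes>v\<in>Poly_Mapping.keys m. f v [^] Poly_Mapping.lookup m v)
      = (\<Otimes>v\<in>Poly_Mapping.keys m. g v [^] Poly_Mapping.lookup m v)"
    using m assms by (intro finprod_cong') (auto simp: polys_in_def subset_iff)
  then show "[Poly_Mapping.lookup p m] \<cdot> (\<Otimes>v\<in>Poly_Mapping.keys m. f v [^] Poly_Mapping.lookup m v)
      = [Poly_Mapping.lookup p m] \<cdot> (\<Otimes>v\<in>Poly_Mapping.keys m. g v [^] Poly_Mapping.lookup m v)"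
    by simp
qed (auto intro!: add.int_pow_closed finprod_closed assms)

lemma meval_msubst:
  assumes f: "\<And>v. f v \<in> carrier R"
  shows "meval R f (msubst g p) = meval R (\<lambda>v. meval R f (g v)) p"
proof -
  have f': "meval R f (g v) \<in> carrier R" for v
    using f by simp
  have "p \<in> polys_in UNIV"
    by (rule polys_in_UNIV)
  then show ?thesis
    by (induction rule: polys_in_induct)
      (simp_all add: meval_add[OF f] meval_mult[OF f] meval_mconst[OF f] meval_mconst[OF f']
        meval_mvar[OF f'] meval_add[OF f'] meval_mult[OF f'])
qed

end


section \<open>The generic rational model\<close>

type_synonym rpoly = "(nat \<times> nat, rat) mpoly"

text \<open>The variables with second index 0 have to be excluded: \<open>mu_poly a 0 i\<close> is
  1, so \<open>ApplyPsi w 1 = w\<close> fails for them.\<close>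

abbreviation pos_vars :: "(nat \<times> nat) set" where
  "pos_vars \<equiv> {(i, j). j > 0}"

section \<open>Conversions between \<lambda> and \<psi> coordinates\<close>

lemma polys_in_pos:
  assumes "p \<in> polys_in {1..n}" shows "p \<in> polys_in {1..}"
  using assms by (rule polys_in_mono) auto

lemma Lop_poly_in: "Lop_poly n \<in> polys_in {1..}"
  unfolding Lop_poly_def
  by (rule polys_in_msubst[where V = UNIV]) (simp_all only: polys_in_UNIV polys_in_pos[OF L_poly_in])

lemma Nop_poly_in: "Nop_poly n \<in> polys_in {1..}"
  unfolding Nop_poly_def
  by (rule polys_in_msubst[where V = UNIV]) (simp_all only: polys_in_UNIV polys_in_pos[OF Pop_poly_in])

lemma msubst_cong_pos:
  assumes "p \<in> polys_in {1..}" "\<And>n. n \<ge> 1 \<Longrightarrow> f n = g n"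
  shows "msubst f p = msubst g p"
  using assms by (intro msubst_cong[OF assms(1)]) auto

lemma L_poly_pos: "L_poly n \<in> polys_in {1..}"
  by (rule polys_in_pos[OF L_poly_in])

lemma to_rat_pos:
  "to_rat (Pop_poly n) \<in> polys_in {1..}" "to_rat (newton_poly n) \<in> polys_in {1..}"
  "to_rat (Nop_poly n) \<in> polys_in {1..}"
  using polys_in_pos[OF Pop_poly_in] polys_in_pos[OF newton_poly_in] Nop_poly_in
  by (auto simp: to_rat_in_polys_in_iff)

lemma msubst_Lop_poly:
  "msubst a (Lop_poly n) = msubst (\<lambda>k. msubst a (L_poly k)) (to_rat (Pop_poly n))"
  by (simp add: Lop_poly_def msubst_msubst)

lemma msubst_Nop_poly:
  "n \<ge> 1 \<Longrightarrow> msubst a (to_rat (Nop_poly n))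
    = msubst (\<lambda>k. msubst a (to_rat (Pop_poly k))) (to_rat (newton_poly n))"
  by (simp add: Nop_poly_def N_poly_eq to_rat_msubst msubst_msubst)

lemma msubst_Pop_poly_Pop_poly:
  "n \<ge> 1 \<Longrightarrow> msubst (\<lambda>k. msubst a (to_rat (Pop_poly k))) (to_rat (Pop_poly n)) = a n"
  unfolding msubst_to_rat by (rule Pop_poly_Pop_poly[OF is_ring_hom_mconst_of_int])

text \<open>\<open>Nop_poly\<close> computes \<psi> from \<lambda> and \<open>Lop_poly\<close> goes
  back. Each is composed of two steps through \<sigma>, and both steps have been inverted
  above.\<close>

lemma Lop_poly_Nop_poly:
  assumes "n \<ge> 1"
  shows "msubst (\<lambda>k. msubst a (to_rat (Nop_poly k))) (Lop_poly n) = a n"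
proof -
  have "msubst (\<lambda>k. msubst a (to_rat (Nop_poly k))) (L_poly m)
      = msubst a (to_rat (Pop_poly m))" if "m \<ge> 1" for m
  proof -
    have "msubst (\<lambda>k. msubst a (to_rat (Nop_poly k))) (L_poly m)
      = msubst (\<lambda>k. msubst (\<lambda>k. msubst a (to_rat (Pop_poly k))) (to_rat (newton_poly k))) (L_poly m)"
      by (rule msubst_cong_pos[OF L_poly_pos]) (simp add: msubst_Nop_poly)
    then show ?thesis
      using L_poly_newton_poly[OF that] by simp
  qed
  then have "msubst (\<lambda>k. msubst a (to_rat (Nop_poly k))) (Lop_poly n)
      = msubst (\<lambda>k. msubst a (to_rat (Pop_poly k))) (to_rat (Pop_poly n))"
    unfolding msubst_Lop_poly by (intro msubst_cong_pos[OF to_rat_pos(1)]) simp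
  then show ?thesis
    using msubst_Pop_poly_Pop_poly[OF assms] by simp
qed

lemma Nop_poly_Lop_poly:
  assumes "n \<ge> 1"
  shows "msubst (\<lambda>k. msubst a (Lop_poly k)) (to_rat (Nop_poly n)) = a n"
proof -
  have "msubst (\<lambda>k. msubst a (Lop_poly k)) (to_rat (Nop_poly n))
      = msubst (\<lambda>k. msubst (\<lambda>k. msubst a (Lop_poly k)) (to_rat (Pop_poly k))) (to_rat (newton_poly n))"
    by (rule msubst_Nop_poly[OF assms])
  also have "\<dots> = msubst (\<lambda>k. msubst a (L_poly k)) (to_rat (newton_poly n))"
    by (rule msubst_cong_pos[OF to_rat_pos(2)])
      (simp add: msubst_Lop_poly msubst_Pop_poly_Pop_poly[where a = "\<lambda>k. msubst a (L_poly k)"])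
  also have "\<dots> = a n"
    by (rule newton_poly_L_poly[OF assms])
  finally show ?thesis .
qed

section \<open>Adams operations on rational polynomials\<close>

lemma Psi_poly_in: "Psi_poly i k \<in> polys_in pos_vars"
  unfolding Psi_poly_def by (rule polys_in_msubst[OF to_rat_pos(3)]) (auto intro: polys_in_mvar)

lemma mu_poly_in: "mu_poly a b i \<in> polys_in pos_vars"
  unfolding mu_poly_def by (rule polys_in_msubst[OF Lop_poly_in]) (rule Psi_poly_in)

lemma is_ring_hom_ApplyPsi: "is_ring_hom (\<lambda>w. ApplyPsi w k)"
  unfolding ApplyPsi_def by (rule is_ring_hom_msubst)

lemmas ApplyPsi_simps = hom_simps[OF is_ring_hom_ApplyPsi]

lemma ApplyPsi_mvar: "ApplyPsi (mvar (i, j)) k = mu_poly k j i"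
  by (simp add: ApplyPsi_def)

lemma ApplyPsi_msubst: "ApplyPsi (msubst f p) k = msubst (\<lambda>v. ApplyPsi (f v) k) p"
  by (simp add: ApplyPsi_def msubst_msubst)

lemma ApplyPsi_in: "ApplyPsi w k \<in> polys_in pos_vars"
  unfolding ApplyPsi_def
  by (rule polys_in_msubst[OF polys_in_UNIV]) (auto intro: mu_poly_in)

lemma mu_poly_1: "j \<ge> 1 \<Longrightarrow> mu_poly 1 j i = mvar (i, j)"
  unfolding mu_poly_def Psi_poly_def
  using Lop_poly_Nop_poly[of j "\<lambda>l. mvar (i, l)"] by simp

lemma ApplyPsi_1:
  assumes "w \<in> polys_in pos_vars"
  shows "ApplyPsi w 1 = w"
  unfolding ApplyPsi_def
  by (rule msubst_id[OF assms]) (use mu_poly_1 in auto)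

text \<open>\<open>Nop_poly\<close> undoes the \<open>Lop_poly\<close> inside
  \<open>mu_poly\<close>, which leaves the Adams operation with multiplied index.\<close>

lemma ApplyPsi_Psi_poly:
  assumes "b \<ge> 1"
  shows "ApplyPsi (Psi_poly i b) a = Psi_poly i (b * a)"
  using Nop_poly_Lop_poly[OF assms, of "\<lambda>l. Psi_poly i (l * a)"]
  by (simp add: Psi_poly_def[of i b] ApplyPsi_msubst ApplyPsi_mvar mu_poly_def)

text \<open>Adams operations with positive indices therefore commute; the composition axiom rests on
  this.\<close>

lemma ApplyPsi_ApplyPsi:
  assumes "b \<ge> 1"
  shows "ApplyPsi (ApplyPsi w b) a = ApplyPsi w (b * a)"
proof -
  have "ApplyPsi (mu_poly b j i) a = mu_poly (b * a) j i" for i j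
  proof -
    have "ApplyPsi (mu_poly b j i) a = msubst (\<lambda>l. ApplyPsi (Psi_poly i (l * b)) a) (Lop_poly j)"
      by (simp add: mu_poly_def ApplyPsi_msubst)
    also have "\<dots> = msubst (\<lambda>l. Psi_poly i (l * (b * a))) (Lop_poly j)"
      by (rule msubst_cong_pos[OF Lop_poly_in]) (use assms in \<open>simp add: ApplyPsi_Psi_poly mult.assoc\<close>)
    finally show ?thesis by (simp add: mu_poly_def)
  qed
  then show ?thesis
    by (simp add: ApplyPsi_def[of w] ApplyPsi_msubst case_prod_unfold)
qed

section \<open>The \<sigma> and \<lambda> operations of the model\<close>

definition rsig :: "nat \<Rightarrow> rpoly \<Rightarrow> rpoly" where
  "rsig k w = msubst (ApplyPsi w) (L_poly k)"

definition rlam :: "nat \<Rightarrow> rpoly \<Rightarrow> rpoly" where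
  "rlam k w = msubst (ApplyPsi w) (Lop_poly k)"

lemma rsig_in: "rsig k w \<in> polys_in pos_vars" and rlam_in: "rlam k w \<in> polys_in pos_vars"
  unfolding rsig_def rlam_def
  by (rule polys_in_msubst[OF polys_in_UNIV], rule ApplyPsi_in)+

text \<open>The \<sigma> operations are elementary symmetric functions with power sums
  \<open>ApplyPsi w\<close>. Identities for them are then checked on power sums, where \<psi> is a
  ring homomorphism.\<close>

lemma newton_rsig: "newton (\<lambda>k. rsig k w) (ApplyPsi w)"
  unfolding rsig_def by (rule newton_L_poly)

lemma rsig_0: "rsig 0 w = 1"
  using newton_rsig[of w] by (simp add: newton_def)

lemma L_poly_1: "L_poly (Suc 0) = mvar 1"
  by (simp add: L_poly.simps)

lemma rsig_1: "w \<in> polys_in pos_vars \<Longrightarrow> rsig 1 w = w"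
  using ApplyPsi_1[of w] by (simp add: rsig_def L_poly_1)

lemma rsig_add: "rsig n (x + y) = conv (\<lambda>k. rsig k x) (\<lambda>k. rsig k y) n"
proof -
  have "newton (conv (\<lambda>k. rsig k x) (\<lambda>k. rsig k y)) (ApplyPsi (x + y))"
    using newton_conv[OF newton_rsig[of x] newton_rsig[of y]]
    by (simp add: ApplyPsi_simps(3)[abs_def])
  then show ?thesis
    using newton_unique_elementary[OF newton_rsig] by blast
qed

lemma rlam_eq: "rlam n w = msubst (\<lambda>k. rsig k w) (to_rat (Pop_poly n))"
  by (simp add: rlam_def rsig_def msubst_Lop_poly)

lemma opposite_rsig_rlam: "opposite (\<lambda>k. rsig k w) (\<lambda>k. rlam k w)"
  unfolding rlam_eq msubst_to_rat
  by (rule opposite_Pop_poly) (simp_all add: is_ring_hom_mconst_of_int rsig_0)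

lemma rlam_add: "rlam n (x + y) = conv (\<lambda>k. rlam k x) (\<lambda>k. rlam k y) n"
proof -
  have "opposite (\<lambda>k. rsig k (x + y)) (conv (\<lambda>k. rlam k x) (\<lambda>k. rlam k y))"
    using opposite_conv[OF opposite_rsig_rlam[of x] opposite_rsig_rlam[of y]]
    by (simp add: rsig_add[abs_def])
  then show ?thesis
    using opposite_unique[OF opposite_rsig_rlam] by metis
qed

lemma rlam_0: "rlam 0 w = 1"
  by (simp add: rlam_eq Pop_poly.simps)

lemma Pop_poly_1: "Pop_poly (Suc 0) = mvar 1"
  by (simp add: Pop_poly.simps[of "Suc 0"] Pop_poly.simps[of 0])

lemma rlam_1: "w \<in> polys_in pos_vars \<Longrightarrow> rlam 1 w = w"
  using rsig_1[of w] by (simp add: rlam_eq Pop_poly_1)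

text \<open>The general rule for \<lambda> agrees with the special rule of the algorithm for a bare
  variable.\<close>

lemma rlam_mvar:
  assumes "k \<ge> 1"
  shows "rlam k (mvar (i, 1)) = mvar (i, k)"
proof -
  have "rlam k (mvar (i, 1)) = msubst (\<lambda>l. Psi_poly i l) (Lop_poly k)"
    unfolding rlam_def
    by (rule msubst_cong_pos[OF Lop_poly_in])
      (simp add: ApplyPsi_mvar mu_poly_def Lop_poly_def Pop_poly_1 L_poly_1)
  then show ?thesis
    using mu_poly_1[OF assms] by (simp add: mu_poly_def)
qed

text \<open>Every \<open>ApplyPsi 1 k\<close> is 1, the power sum of a single root 1, so the
  \<sigma> series of 1 is 1 + t.\<close>

lemma rsig_one: "n \<ge> 2 \<Longrightarrow> rsig n 1 = 0"
proof -
  assume "n \<ge> 2"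
  have "newton (coeff [:1, 1:]) (ApplyPsi 1)"
    using newton_linear[of "1 :: rpoly"] by (simp add: ApplyPsi_simps(2)[abs_def])
  then have "rsig n 1 = coeff [:1, 1:] n"
    by (rule newton_unique_elementary[OF newton_rsig])
  then show ?thesis
    using \<open>n \<ge> 2\<close> by (simp add: coeff_eq_0)
qed

lemma newton_poly_rsig: "i \<ge> 1 \<Longrightarrow> msubst (\<lambda>k. rsig k w) (to_rat (newton_poly i)) = ApplyPsi w i"
  unfolding rsig_def by (rule newton_poly_L_poly)

lemma rsig_mult:
  "rsig n (x * y) = msubst (case_sum (\<lambda>i. rsig i x) (\<lambda>i. rsig i y)) (to_rat (P_poly n))"
proof -
  have "msubst (case_sum (\<lambda>i. rsig i x) (\<lambda>i. rsig i y)) (to_rat (P_poly n)) =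
     msubst (\<lambda>i. msubst (\<lambda>k. rsig k x) (to_rat (newton_poly i)) *
       msubst (\<lambda>k. rsig k y) (to_rat (newton_poly i))) (L_poly n)"
    by (simp add: P_poly_characterization msubst_msubst)
  also have "\<dots> = msubst (\<lambda>i. ApplyPsi x i * ApplyPsi y i) (L_poly n)"
    by (rule msubst_cong_pos[OF L_poly_pos]) (simp add: newton_poly_rsig)
  finally show ?thesis
    by (simp add: rsig_def ApplyPsi_simps(4)[abs_def])
qed

text \<open>Since \<psi> is a ring homomorphism it passes through \<open>L_poly m\<close>, and the
  two Adams operations merge into the one of index \<open>i * j\<close>.\<close>

lemma rsig_rsig: "rsig n (rsig m x) = msubst (\<lambda>i. rsig i x) (to_rat (P_comp_poly n m))"
proof -
  have "rsig n (rsig m x) = msubst (\<lambda>i. msubst (\<lambda>j. ApplyPsi (ApplyPsi x j) i) (L_poly m)) (L_poly n)"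
    by (simp add: rsig_def ApplyPsi_msubst[abs_def])
  also have "\<dots> = msubst (\<lambda>i. msubst (\<lambda>j. msubst (\<lambda>k. rsig k x) (to_rat (newton_poly (i * j)))) (L_poly m)) (L_poly n)"
  proof (intro msubst_cong_pos[OF L_poly_pos])
    fix i j :: nat assume "i \<ge> 1" "j \<ge> 1"
    then have "i * j \<ge> 1" by simp
    then show "ApplyPsi (ApplyPsi x j) i = msubst (\<lambda>k. rsig k x) (to_rat (newton_poly (i * j)))"
      using \<open>j \<ge> 1\<close> by (simp add: ApplyPsi_ApplyPsi newton_poly_rsig mult.commute)
  qed
  finally show ?thesis
    by (simp add: P_comp_poly_characterization msubst_msubst)
qed

lemma simplification_Lam: "1 \<le> k \<Longrightarrow> simplification (Lam k s) = rlam k (simplification s)"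
  by (cases s) (simp_all add: rlam_def[symmetric] rlam_mvar del: One_nat_def)

lemma simplification_Sig: "simplification (Sig k s) = rsig k (simplification s)"
  by (simp add: rsig_def)

text \<open>Transport along an injection makes the same construction available on \<open>nat\<close>, too.\<close>

definition transported_ring :: "('u::comm_ring_1 \<Rightarrow> 'c) \<Rightarrow> 'u set \<Rightarrow> 'c ring" where
  "transported_ring h C = \<lparr>carrier = h ` C, mult = (\<lambda>x y. h (inv_into UNIV h x * inv_into UNIV h y)), one = h 1,
     zero = h 0, add = (\<lambda>x y. h (inv_into UNIV h x + inv_into UNIV h y))\<rparr>"

text \<open>Only injectivity of \<open>h\<close> is asked for: the identity gives the rational model
  itself, an injection into \<open>nat\<close> its countable copy.\<close>

locale transport =
  fixes h :: "'u::comm_ring_1 \<Rightarrow> 'c" and C :: "'u set"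
  assumes inj_h: "inj h" and zero_C: "0 \<in> C" and one_C: "1 \<in> C"
    and add_C: "\<And>a b. a \<in> C \<Longrightarrow> b \<in> C \<Longrightarrow> a + b \<in> C"
    and mult_C: "\<And>a b. a \<in> C \<Longrightarrow> b \<in> C \<Longrightarrow> a * b \<in> C"
    and uminus_C: "\<And>a. a \<in> C \<Longrightarrow> - a \<in> C"
begin

abbreviation "R \<equiv> transported_ring h C"

lemma R_simps [simp]: "carrier R = h ` C" "\<one>\<^bsub>R\<^esub> = h 1" "\<zero>\<^bsub>R\<^esub> = h 0"
  "h a \<otimes>\<^bsub>R\<^esub> h b = h (a * b)" "h a \<oplus>\<^bsub>R\<^esub> h b = h (a + b)" "inv_into UNIV h (h a) = a"
  using inj_h by (simp_all add: transported_ring_def)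

lemma cring_R: "cring R"
proof (intro cringI abelian_groupI comm_monoidI)
  show "\<exists>y\<in>carrier R. y \<oplus>\<^bsub>R\<^esub> x = \<zero>\<^bsub>R\<^esub>" if x: "x \<in> carrier R" for x
  proof -
    obtain a where a: "a \<in> C" "x = h a" using x by auto
    show ?thesis
      by (rule bexI[of _ "h (- a)"]) (use a in \<open>auto simp: uminus_C\<close>)
  qed
qed (auto simp: algebra_simps zero_C one_C add_C mult_C)

sublocale R: cring R
  by (rule cring_R)

lemma of_int_C: "of_int n \<in> C"
proof -
  have "of_nat k \<in> C" for k
    by (induction k) (auto simp: zero_C one_C add_C)
  then show ?thesis
    using add_C uminus_C by (cases n rule: int_diff_cases) (auto simp flip: add_uminus_conv_diff)
qed

lemma R_uminus: "a \<in> C \<Longrightarrow> \<ominus>\<^bsub>R\<^esub> h a = h (- a)"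
  by (rule R.minus_equality) (auto simp: uminus_C)

lemma R_pow: "a \<in> C \<Longrightarrow> h a [^]\<^bsub>R\<^esub> n = h (a ^ n)" for n :: nat
  by (induction n) (simp_all add: mult.commute)

lemma R_finsum: "(\<And>x. x \<in> A \<Longrightarrow> f x \<in> C) \<Longrightarrow> (\<Oplus>\<^bsub>R\<^esub>x\<in>A. h (f x)) = h (sum f A)"
  by (induction A rule: infinite_finite_induct) (auto simp: Pi_def)

lemma R_add_pow_int: "[(n :: int)] \<cdot>\<^bsub>R\<^esub> h 1 = h (of_int n)"
proof -
  have nat: "[k] \<cdot>\<^bsub>R\<^esub> h 1 = h (of_nat k)" for k :: nat
    by (induction k) (simp_all add: add.commute)
  have "of_nat k \<in> C" for k
    using of_int_C[of "int k"] by simp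
  then show ?thesis
    by (cases "n \<ge> 0") (simp_all add: add_pow_int_ge add_pow_int_lt nat R_uminus of_int_C uminus_C)
qed

lemma meval_R:
  assumes f: "\<And>v. f v \<in> C"
  shows "meval R (\<lambda>v. h (f v)) p = h (peval of_int f p)"
proof -
  have f': "h (f v) \<in> carrier R" for v
    using f by simp
  note peval = hom_simps[OF is_ring_hom_peval[OF is_ring_hom_of_int]]
    peval_mconst[OF is_ring_hom_of_int] peval_mvar[OF is_ring_hom_of_int]
  have "p \<in> polys_in UNIV"
    by (rule polys_in_UNIV)
  then show ?thesis
    by (induction rule: polys_in_induct)
      (simp_all add: R.meval_mconst[OF f'] R.meval_mvar[OF f'] R.meval_add[OF f'] R.meval_mult[OF f']
        peval R_add_pow_int del: R.one_closed)
qed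

end

lemma of_int_eq_mconst: "of_int c = mconst (of_int c)"
  by (simp add: mconst_def)

lemma peval_of_int: "peval of_int f p = msubst f (to_rat p)"
  by (simp add: msubst_to_rat of_int_eq_mconst[abs_def])

lemma lambda_model_transported:
  fixes h :: "rpoly \<Rightarrow> 'c"
  assumes "inj h"
  shows "lambda_model (transported_ring h (polys_in pos_vars)) (\<lambda>k x. h (rlam k (inv_into UNIV h x)))
    (\<lambda>k x. h (rsig k (inv_into UNIV h x))) (\<lambda>k x. h (ApplyPsi (inv_into UNIV h x) k))"
proof -
  let ?C = "polys_in pos_vars"
  interpret transport h ?C
    by unfold_locales (auto simp: assms intro: polys_in_intros)
  have finsum: "(\<Oplus>\<^bsub>R\<^esub>i\<in>{..n}. h (f i) \<otimes>\<^bsub>R\<^esub> h (g (n - i))) = h (conv f g n)"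
    if "\<And>i. f i \<in> ?C" "\<And>i. g i \<in> ?C" for f g n
    using that unfolding conv_def R_simps by (intro R_finsum mult_C)
  show ?thesis
  proof unfold_locales
    fix x assume "x \<in> carrier R"
    then obtain a where a: "a \<in> ?C" "x = h a" by auto
    show "ps_mult R (\<lambda>i. h (rsig i (inv_into UNIV h x))) (\<lambda>i. (\<ominus>\<^bsub>R\<^esub> \<one>\<^bsub>R\<^esub>) [^]\<^bsub>R\<^esub> i \<otimes>\<^bsub>R\<^esub> h (rlam i (inv_into UNIV h x)))
        = ps_one R"
    proof
      fix n
      have "(\<ominus>\<^bsub>R\<^esub> \<one>\<^bsub>R\<^esub>) [^]\<^bsub>R\<^esub> i \<otimes>\<^bsub>R\<^esub> h (rlam i (inv_into UNIV h x)) = h ((- 1) ^ i * rlam i a)" for i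
        by (simp only: a R_simps R_uminus[OF one_C] R_pow[OF uminus_C[OF one_C]])
      moreover have "(-1) ^ i * rlam i a \<in> ?C" for i
        by (intro polys_in_intros rlam_in)
      ultimately have "ps_mult R (\<lambda>i. h (rsig i (inv_into UNIV h x)))
          (\<lambda>i. (\<ominus>\<^bsub>R\<^esub> \<one>\<^bsub>R\<^esub>) [^]\<^bsub>R\<^esub> i \<otimes>\<^bsub>R\<^esub> h (rlam i (inv_into UNIV h x))) n
        = h (conv (\<lambda>i. rsig i a) (\<lambda>i. (-1) ^ i * rlam i a) n)"
        unfolding ps_mult_def
        using a finsum[of "\<lambda>i. rsig i a" "\<lambda>i. (-1) ^ i * rlam i a" n, OF rsig_in]
        by (simp only: R_simps(6))
      also have "\<dots> = h (if n = 0 then 1 else 0)"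
        \<comment> \<open>The axiom wants \<sigma> at t times \<lambda> at -t, whereas
          \<open>opposite_rsig_rlam\<close> has the roles exchanged.\<close>
        using opposite_sym[OF opposite_rsig_rlam[of a]] by (simp add: opposite_iff conv_def)
      finally show "ps_mult R (\<lambda>i. h (rsig i (inv_into UNIV h x)))
          (\<lambda>i. (\<ominus>\<^bsub>R\<^esub> \<one>\<^bsub>R\<^esub>) [^]\<^bsub>R\<^esub> i \<otimes>\<^bsub>R\<^esub> h (rlam i (inv_into UNIV h x))) n = ps_one R n"
        by (simp add: ps_one_def)
    qed
    show "h (ApplyPsi (inv_into UNIV h x) k) = meval R (\<lambda>i. h (rsig i (inv_into UNIV h x))) (N_poly k)" if "k \<ge> 1" for k
      using that by (simp add: meval_R[OF rsig_in] peval_of_int N_poly_eq newton_poly_rsig)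
    show "h (rsig n (inv_into UNIV h (h (rsig m (inv_into UNIV h x))))) = meval R (\<lambda>i. h (rsig i (inv_into UNIV h x))) (P_comp_poly n m)"
      for n m
      by (simp add: meval_R[OF rsig_in] peval_of_int rsig_rsig)
    show "h (rlam 1 (inv_into UNIV h x)) = x" "h (rsig 1 (inv_into UNIV h x)) = x"
      using a rlam_1[OF a(1)] rsig_1[OF a(1)] by (simp_all only: R_simps)
    show "h (rlam k (inv_into UNIV h x)) \<in> carrier R" "h (rsig k (inv_into UNIV h x)) \<in> carrier R" for k
      using rlam_in rsig_in by auto
    fix y assume "y \<in> carrier R"
    then obtain b where b: "b \<in> ?C" "y = h b" by auto
    show "h (rlam n (inv_into UNIV h (x \<oplus>\<^bsub>R\<^esub> y)))
        = (\<Oplus>\<^bsub>R\<^esub>i\<in>{0..n}. h (rlam i (inv_into UNIV h x)) \<otimes>\<^bsub>R\<^esub> h (rlam (n - i) (inv_into UNIV h y)))" for n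
      unfolding a b atLeast0AtMost R_simps(5,6) by (subst finsum) (simp_all only: rlam_in rlam_add)
    show "h (rsig n (inv_into UNIV h (x \<oplus>\<^bsub>R\<^esub> y)))
        = (\<Oplus>\<^bsub>R\<^esub>i\<in>{0..n}. h (rsig i (inv_into UNIV h x)) \<otimes>\<^bsub>R\<^esub> h (rsig (n - i) (inv_into UNIV h y)))" for n
      unfolding a b atLeast0AtMost R_simps(5,6) by (subst finsum) (simp_all only: rsig_in rsig_add)
    show "h (rsig n (inv_into UNIV h (x \<otimes>\<^bsub>R\<^esub> y))) = meval R (case_sum (\<lambda>i. h (rsig i (inv_into UNIV h x)))
        (\<lambda>i. h (rsig i (inv_into UNIV h y)))) (P_poly n)" for n
    proof -
      have "case_sum (\<lambda>i. h (rsig i a)) (\<lambda>i. h (rsig i b))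
          = (\<lambda>v. h (case_sum (\<lambda>i. rsig i a) (\<lambda>i. rsig i b) v))"
        by (auto split: sum.splits)
      moreover have "case_sum (\<lambda>i. rsig i a) (\<lambda>i. rsig i b) v \<in> ?C" for v
        using rsig_in by (auto split: sum.splits)
      ultimately show ?thesis
        by (simp only: a b R_simps(4,6) meval_R peval_of_int rsig_mult)
    qed
  qed (simp_all add: rsig_0 rlam_0 rsig_one)
qed


section \<open>Polynomials representing terms\<close>

type_synonym ipoly = "(nat \<times> nat, int) mpoly"

text \<open>\<open>sig_formula p f\<close>: reading the variable \<open>(i, j)\<close> as \<open>\<sigma>\<^sup>j(x\<^sub>i)\<close>, the
  polynomial \<open>f k\<close> is \<open>\<sigma>\<^sup>k(p)\<close> in every special \<open>\<lambda>\<close>-ring.\<close>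

inductive sig_formula :: "ipoly \<Rightarrow> (nat \<Rightarrow> ipoly) \<Rightarrow> bool" where
  one: "sig_formula 1 (\<lambda>k. if k \<le> 1 then 1 else 0)"
| var: "j \<ge> 1 \<Longrightarrow> sig_formula (mvar (i, j))
    (\<lambda>k. if k = 0 then 1 else msubst (\<lambda>l. mvar (i, l)) (P_comp_poly k j))"
| neg: "sig_formula p f \<Longrightarrow> sig_formula (- p) (\<lambda>k. msubst (\<lambda>i. (-1) ^ i * f i) (Pop_poly k))"
| add: "sig_formula p f \<Longrightarrow> sig_formula q g \<Longrightarrow> sig_formula (p + q) (conv f g)"
| mult: "sig_formula p f \<Longrightarrow> sig_formula q g \<Longrightarrow>
    sig_formula (p * q) (\<lambda>k. if k = 0 then 1 else msubst (case_sum f g) (P_poly k))"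

lemma sig_formula_0: "sig_formula p f \<Longrightarrow> f 0 = 1"
  by (induction rule: sig_formula.induct) (simp_all add: Pop_poly.simps conv_def)

definition vars_upto :: "(nat \<Rightarrow> nat) \<Rightarrow> (nat \<times> nat) set" where
  "vars_upto d = {(i, j). 1 \<le> j \<and> j \<le> d i}"

lemma vars_upto_mono: "(\<And>i. d i \<le> d' i) \<Longrightarrow> vars_upto d \<subseteq> vars_upto d'"
  by (auto simp: vars_upto_def intro: order_trans)

lemma polys_in_vars_upto_mono:
  "p \<in> polys_in (vars_upto d) \<Longrightarrow> (\<And>i. d i \<le> d' i) \<Longrightarrow> p \<in> polys_in (vars_upto d')"
  using polys_in_mono vars_upto_mono by blast

text \<open>Integers are generated by 1 under addition and negation, and these rules introduce no
  variables.\<close>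

lemma sig_formula_mconst: "\<exists>f. sig_formula (mconst c) f \<and> (\<forall>k. f k \<in> polys_in {})"
proof -
  let ?P = "\<lambda>p. \<exists>f. sig_formula p f \<and> (\<forall>k. f k \<in> polys_in {})"
  have add: "?P (p + q)" if "?P p" "?P q" for p q
  proof -
    obtain f g where "sig_formula p f" "\<forall>k. f k \<in> polys_in {}" "sig_formula q g" "\<forall>k. g k \<in> polys_in {}"
      using \<open>?P p\<close> \<open>?P q\<close> by blast
    then show ?thesis
      by (intro exI[of _ "conv f g"]) (auto intro: sig_formula.add simp: conv_def intro!: polys_in_intros)
  qed
  have neg: "?P (- p)" if "?P p" for p
  proof -
    obtain f where f: "sig_formula p f" "\<forall>k. f k \<in> polys_in {}"
      using \<open>?P p\<close> by blast
    have "msubst (\<lambda>i. (-1) ^ i * f i) (Pop_poly k) \<in> polys_in {}" for k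
      by (rule polys_in_msubst[OF polys_in_UNIV]) (auto intro!: polys_in_intros simp: f)
    with sig_formula.neg[OF f(1)] show ?thesis by blast
  qed
  have one: "?P 1"
    by (intro exI[of _ "\<lambda>k. if k \<le> 1 then 1 else 0"] conjI sig_formula.one)
      (auto intro: polys_in_intros)
  have zero: "?P 0"
    using add[OF one neg[OF one]] by simp
  have nat: "?P (of_nat k)" for k
    by (induction k) (simp_all only: of_nat_0 of_nat_Suc zero add one)
  have "mconst (of_int c) = (of_int c :: ipoly)"
    by (simp only: mconst_def single_of_int)
  moreover have "?P (of_int c)"
  proof (cases c rule: int_diff_cases)
    case (diff m n)
    then show ?thesis
      using add[OF nat[of m] neg[OF nat[of n]]] by simp
  qed
  ultimately show ?thesis by (simp only: of_int_eq_id id_apply)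
qed

text \<open>The depth bound survives each rule: products and convolutions use only indices up to
  \<open>k\<close>, and \<sigma> of index \<open>k\<close> applied to \<sigma> of index
  \<open>j\<close> needs indices up to \<open>k * j\<close>.\<close>

lemma sig_formula_exists:
  assumes "p \<in> polys_in (vars_upto d)"
  shows "\<exists>f. sig_formula p f \<and> (\<forall>k. f k \<in> polys_in (vars_upto (\<lambda>i. k * d i)))"
  using assms
proof (induction rule: polys_in_induct)
  case (const c)
  obtain f where "sig_formula (mconst c) f" "\<And>k. f k \<in> polys_in {}"
    using sig_formula_mconst by blast
  then show ?case
    by (intro exI[of _ f] conjI allI) (auto intro: polys_in_mono)
next
  case (var v)
  then obtain i j where v: "v = (i, j)" "1 \<le> j" "j \<le> d i"
    by (auto simp: vars_upto_def)
  have "msubst (\<lambda>l. mvar (i, l)) (P_comp_poly k j) \<in> polys_in (vars_upto (\<lambda>i. k * d i))" for k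
  proof (rule polys_in_msubst[OF P_comp_poly_characterization(1)], rule polys_in_mvar)
    fix l assume l: "l \<in> {1..k * j}"
    then have "l \<le> k * j" by simp
    also have "\<dots> \<le> k * d i"
      using v(3) by simp
    finally show "(i, l) \<in> vars_upto (\<lambda>i. k * d i)"
      using l by (simp add: vars_upto_def)
  qed
  then show ?case
    unfolding v(1) using sig_formula.var[OF v(2), of i]
    by (intro exI[of _ "\<lambda>k. if k = 0 then 1 else msubst (\<lambda>l. mvar (i, l)) (P_comp_poly k j)"])
      (auto intro: polys_in_1)
next
  case (add p q)
  then obtain f g where f: "sig_formula p f" "\<And>k. f k \<in> polys_in (vars_upto (\<lambda>i. k * d i))"
    and g: "sig_formula q g" "\<And>k. g k \<in> polys_in (vars_upto (\<lambda>i. k * d i))"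
    by blast
  have "conv f g k \<in> polys_in (vars_upto (\<lambda>i. k * d i))" for k
    unfolding conv_def
    by (intro polys_in_sum polys_in_mult polys_in_vars_upto_mono[OF f(2)]
        polys_in_vars_upto_mono[OF g(2)]) auto
  then show ?case
    using sig_formula.add[OF f(1) g(1)] by blast
next
  case (mult p q)
  then obtain f g where f: "sig_formula p f" "\<And>k. f k \<in> polys_in (vars_upto (\<lambda>i. k * d i))"
    and g: "sig_formula q g" "\<And>k. g k \<in> polys_in (vars_upto (\<lambda>i. k * d i))"
    by blast
  have "msubst (case_sum f g) (P_poly k) \<in> polys_in (vars_upto (\<lambda>i. k * d i))" for k
  proof (rule polys_in_msubst[OF P_poly_characterization(1)])
    have "f l \<in> polys_in (vars_upto (\<lambda>i. k * d i))" "g l \<in> polys_in (vars_upto (\<lambda>i. k * d i))"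
      if "l \<le> k" for l
      by (rule polys_in_vars_upto_mono[OF f(2)] polys_in_vars_upto_mono[OF g(2)], simp add: that)+
    then show "case_sum f g v \<in> polys_in (vars_upto (\<lambda>i. k * d i))"
      if "v \<in> Inl ` {1..k} \<union> Inr ` {1..k}" for v
      using that by auto
  qed
  then have "(if k = 0 then 1 else msubst (case_sum f g) (P_poly k))
      \<in> polys_in (vars_upto (\<lambda>i. k * d i))" for k
    by (simp add: polys_in_1)
  then show ?case
    using sig_formula.mult[OF f(1) g(1)] by blast
qed

section \<open>Power series over a ring with carrier\<close>

text \<open>A series with constant term 1 can be cancelled: the n-th equation determines
  \<open>b n\<close> from the earlier coefficients.\<close>

lemma (in cring) power_series_cancel:
  assumes a: "\<And>i. a i \<in> carrier R" and b: "\<And>i. b i \<in> carrier R" and b': "\<And>i. b' i \<in> carrier R"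
    and a0: "a 0 = \<one>"
    and eq: "\<And>n. (\<Oplus>i\<in>{..n}. b i \<otimes> a (n - i)) = (\<Oplus>i\<in>{..n}. b' i \<otimes> a (n - i))"
  shows "b (n :: nat) = b' n"
proof (induction n rule: less_induct)
  case (less n)
  have split: "(\<Oplus>i\<in>{..n}. c i \<otimes> a (n - i)) = c n \<oplus> (\<Oplus>i\<in>{..<n}. c i \<otimes> a (n - i))"
    if c: "\<And>i. c i \<in> carrier R" for c
  proof -
    have "{..n} = insert n {..<n}" by auto
    then show ?thesis
      using c a by (simp add: a0 Pi_def)
  qed
  have "(\<Oplus>i\<in>{..<n}. b i \<otimes> a (n - i)) = (\<Oplus>i\<in>{..<n}. b' i \<otimes> a (n - i))"
    using less.IH a b' by (intro add.finprod_cong') auto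
  moreover have "(\<Oplus>i\<in>{..<n}. b' i \<otimes> a (n - i)) \<in> carrier R"
    using a b' by (intro finsum_closed) auto
  ultimately show ?case
    using eq[of n] b b' by (simp add: split add.right_cancel)
qed

lemma (in cring) finsum_delta:
  assumes "\<And>i. a i \<in> carrier R"
  shows "(\<Oplus>i\<in>{..n :: nat}. (if i = 0 then \<one> else \<zero>) \<otimes> a (n - i)) = a n"
proof -
  have "(\<Oplus>i\<in>{..n}. (if i = 0 then \<one> else \<zero>) \<otimes> a (n - i))
      = (\<Oplus>i\<in>{..n}. if 0 = i then a (n - i) else \<zero>)"
    by (intro add.finprod_cong') (auto simp: assms)
  also have "\<dots> = a (n - 0)"
    by (rule add.finprod_singleton) (auto simp: assms)
  finally show ?thesis by simp
qed

lemma (in cring) meval_conv: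
  assumes "\<And>v. f v \<in> carrier R"
  shows "meval R f (conv p q n) = (\<Oplus>i\<in>{..n}. meval R f (p i) \<otimes> meval R f (q (n - i)))"
  by (simp add: conv_def meval_sum[OF assms] meval_mult[OF assms])

context special_lambda_ring
begin

lemma tau_add_atMost:
  "x \<in> carrier R \<Longrightarrow> y \<in> carrier R \<Longrightarrow> tau n (x \<oplus> y) = (\<Oplus>i\<in>{..n}. tau i x \<otimes> tau (n - i) y)"
  using lam_add[of x y n] by (simp add: atLeast0AtMost)

text \<open>Writing 1 as 0 + 1 and cancelling the series of 1 leaves the constant series 1 for
  0.\<close>

lemma tau_zero: "tau n \<zero> = (if n = 0 then \<one> else \<zero>)"
proof (rule power_series_cancel[where a = "\<lambda>n. tau n \<one>" and b = "\<lambda>n. tau n \<zero>"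
      and b' = "\<lambda>n. if n = 0 then \<one> else \<zero>" and n = n])
  fix n
  show "(\<Oplus>i\<in>{..n}. tau i \<zero> \<otimes> tau (n - i) \<one>)
      = (\<Oplus>i\<in>{..n}. (if i = 0 then \<one> else \<zero>) \<otimes> tau (n - i) \<one>)"
    using tau_add_atMost[of \<zero> \<one> n] by (subst finsum_delta) (simp_all add: lam_closed)
qed (simp_all add: lam_closed lam_0)

text \<open>The series of a negative is the inverse series, as their product is the series of
  0.\<close>

lemma tau_uminus_unique:
  assumes x: "x \<in> carrier R" and b: "\<And>i. b i \<in> carrier R"
    and eq: "\<And>n. (\<Oplus>i\<in>{..n}. b i \<otimes> tau (n - i) x) = (if n = 0 then \<one> else \<zero>)"
  shows "tau n (\<ominus> x) = b n"
proof (rule power_series_cancel[where a = "\<lambda>n. tau n x" and b = "\<lambda>n. tau n (\<ominus> x)"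
      and b' = b and n = n])
  fix n
  have "(\<Oplus>i\<in>{..n}. tau i (\<ominus> x) \<otimes> tau (n - i) x) = tau n \<zero>"
    using tau_add_atMost[of "\<ominus> x" x n] x by (simp add: l_neg)
  then show "(\<Oplus>i\<in>{..n}. tau i (\<ominus> x) \<otimes> tau (n - i) x) = (\<Oplus>i\<in>{..n}. b i \<otimes> tau (n - i) x)"
    by (simp add: eq tau_zero)
qed (simp_all add: lam_closed lam_0 x b)

lemma sig_formula_sound:
  assumes r: "\<And>i. r i \<in> carrier R" and "sig_formula p f"
  shows "tau k (meval R (\<lambda>(i, j). tau j (r i)) p) = meval R (\<lambda>(i, j). tau j (r i)) (f k)"
proof -
  let ?e = "\<lambda>(i, j). tau j (r i)"
  have e: "?e v \<in> carrier R" for v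
    by (simp add: lam_closed r split: prod.splits)
  note ev = meval_0[OF e] meval_1[OF e] meval_add[OF e] meval_mult[OF e] meval_uminus[OF e]
    meval_mvar[OF e] meval_conv[OF e] meval_msubst[OF e] meval_closed[OF e]
  show ?thesis
    using assms(2)
  proof (induction arbitrary: k rule: sig_formula.induct)
    case one
    consider "k = 0" | "k = 1" | "k \<ge> 2" by linarith
    then show ?case
      by cases (simp_all only: ev lam_0 lam_1 one_closed tau_one if_True if_False le_refl le_0_eq, simp_all add: ev)
  next
    case (var j i)
    show ?case
    proof (cases "k = 0")
      case False
      then show ?thesis
        using var r tau_comp[of "r i" k j] by (simp add: ev)
    qed (simp add: ev lam_0 lam_closed r)
  next
    case (neg p f)
    \<comment> \<open>\<open>Pop_poly\<close> inverts a series at -t; the signs put on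
      \<open>f\<close> undo this, so the result is the plain inverse of the series of
      \<open>f\<close>.\<close>
    have "opposite (\<lambda>i. (-1) ^ i * f i) (\<lambda>k. msubst (\<lambda>i. (-1) ^ i * f i) (Pop_poly k))"
      unfolding msubst_eq_peval
      by (rule opposite_Pop_poly[OF is_ring_hom_mconst]) (simp add: sig_formula_0[OF neg.hyps])
    then have "conv (\<lambda>k. msubst (\<lambda>i. (-1) ^ i * f i) (Pop_poly k)) f n = (if n = 0 then 1 else 0)" for n
      by (simp add: opposite_iff conv_def flip: mult.assoc power_mult_distrib)
    then have "meval R ?e (conv (\<lambda>k. msubst (\<lambda>i. (-1) ^ i * f i) (Pop_poly k)) f n)
        = (if n = 0 then \<one> else \<zero>)" for n
      by (simp add: ev)
    then have "tau k (\<ominus> meval R ?e p) = meval R ?e (msubst (\<lambda>i. (-1) ^ i * f i) (Pop_poly k))"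
      by (intro tau_uminus_unique) (simp_all only: neg.IH ev(7,9))
    then show ?case by (simp only: ev(5))
  next
    case (add p f q g)
    then show ?case by (simp add: ev tau_add_atMost)
  next
    case (mult p f q g)
    show ?case
    proof (cases "k = 0")
      case False
      have "(\<lambda>v. meval R ?e (case_sum f g v)) = case_sum (\<lambda>i. meval R ?e (f i)) (\<lambda>i. meval R ?e (g i))"
        by (auto split: sum.splits)
      then show ?thesis
        using False by (simp add: ev tau_mult mult.IH)
    qed (simp add: ev lam_0)
  qed
qed

end

text \<open>\<open>term_formula \<phi> p\<close>: the polynomial \<open>p\<close> in the \<open>\<sigma>\<^sup>j(x\<^sub>i)\<close> represents \<open>\<phi>\<close>.\<close>

inductive term_formula :: "lterm \<Rightarrow> ipoly \<Rightarrow> bool" where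
  Zero: "term_formula Zero 0"
| One: "term_formula One 1"
| Var: "term_formula (Var i) (mvar (i, 1))"
| Neg: "term_formula s p \<Longrightarrow> term_formula (Neg s) (- p)"
| Add: "term_formula s p \<Longrightarrow> term_formula t q \<Longrightarrow> term_formula (Add s t) (p + q)"
| Mul: "term_formula s p \<Longrightarrow> term_formula t q \<Longrightarrow> term_formula (Mul s t) (p * q)"
| Lam: "term_formula s p \<Longrightarrow> sig_formula p f \<Longrightarrow> term_formula (Lam k s) (msubst f (Pop_poly k))"
| Sig: "term_formula s p \<Longrightarrow> sig_formula p f \<Longrightarrow> term_formula (Sig k s) (f k)"
| Psi: "term_formula s p \<Longrightarrow> sig_formula p f \<Longrightarrow> k \<ge> 1 \<Longrightarrow> term_formula (Psi k s) (msubst f (N_poly k))"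

text \<open>The bound \<open>k * d\<close> from \<open>sig_formula_exists\<close> matches the
  recursion of \<open>depth\<close>, and \<open>Pop_poly k\<close> and \<open>N_poly k\<close> use
  \<sigma> only up to index \<open>k\<close>.\<close>

lemma term_formula_exists:
  assumes "is_term n \<phi>"
  shows "\<exists>p. term_formula \<phi> p \<and> p \<in> polys_in (vars_upto (depth \<phi>))"
  using assms
proof (induction \<phi>)
  case (Add s t)
  then obtain p q where "term_formula s p" "p \<in> polys_in (vars_upto (depth s))"
    "term_formula t q" "q \<in> polys_in (vars_upto (depth t))" by auto
  then show ?case
    by (intro exI[of _ "p + q"] conjI term_formula.Add polys_in_add)
      (assumption | rule polys_in_vars_upto_mono, assumption, simp)+
next
  case (Mul s t)
  then obtain p q where "term_formula s p" "p \<in> polys_in (vars_upto (depth s))"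
    "term_formula t q" "q \<in> polys_in (vars_upto (depth t))" by auto
  then show ?case
    by (intro exI[of _ "p * q"] conjI term_formula.Mul polys_in_mult)
      (assumption | rule polys_in_vars_upto_mono, assumption, simp)+
next
  case (Lam k s)
  then obtain p where "term_formula s p" "p \<in> polys_in (vars_upto (depth s))"
    by auto
  then obtain f where p: "term_formula s p" "sig_formula p f"
    and f: "\<And>k. f k \<in> polys_in (vars_upto (\<lambda>i. k * depth s i))"
    using sig_formula_exists by blast
  have "msubst f (Pop_poly k) \<in> polys_in (vars_upto (depth (Lam k s)))"
    by (rule polys_in_msubst[OF Pop_poly_in]) (rule polys_in_vars_upto_mono[OF f], simp)
  then show ?case using term_formula.Lam[OF p(1,2)] by blast
next
  case (Sig k s)
  then obtain p where "term_formula s p" "p \<in> polys_in (vars_upto (depth s))"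
    by auto
  then obtain f where p: "term_formula s p" "sig_formula p f"
    and f: "\<And>k. f k \<in> polys_in (vars_upto (\<lambda>i. k * depth s i))"
    using sig_formula_exists by blast
  then have "f k \<in> polys_in (vars_upto (depth (Sig k s)))"
    by simp
  then show ?case using term_formula.Sig[OF p(1,2)] by blast
next
  case (Psi k s)
  then obtain p where "term_formula s p" "p \<in> polys_in (vars_upto (depth s))"
    by auto
  then obtain f where p: "term_formula s p" "sig_formula p f"
    and f: "\<And>k. f k \<in> polys_in (vars_upto (\<lambda>i. k * depth s i))"
    using sig_formula_exists by blast
  have k: "k \<ge> 1" using Psi.prems by simp
  have "msubst f (N_poly k) \<in> polys_in (vars_upto (depth (Psi k s)))"
    by (rule polys_in_msubst[OF N_poly_in[OF k]]) (rule polys_in_vars_upto_mono[OF f], simp)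
  then show ?case using term_formula.Psi[OF p(1,2) k] by blast
next
  case (Neg s)
  then show ?case by (auto intro: term_formula.Neg polys_in_uminus)
next
  case (Var i)
  have "mvar (i, 1) \<in> polys_in (vars_upto (depth (Var i)))"
    by (rule polys_in_mvar) (simp add: vars_upto_def)
  then show ?case using term_formula.Var by blast
qed (auto intro: term_formula.intros polys_in_intros)

lemma opposite_mvar_Pop_poly: "opposite (\<lambda>k. if k = 0 then 1 else mvar k) Pop_poly"
proof -
  let ?a = "\<lambda>k. if k = 0 then 1 else mvar k :: (nat, int) mpoly"
  have "msubst ?a (Pop_poly k) = Pop_poly k" for k
    by (rule msubst_id[OF Pop_poly_in]) auto
  then show ?thesis
    using opposite_Pop_poly[OF is_ring_hom_mconst, of ?a] by (simp add: msubst_eq_peval)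
qed

lemma (in cring) meval_minus_one_power:
  assumes "\<And>v. f v \<in> carrier R"
  shows "meval R f ((-1) ^ n) = (\<ominus> \<one>) [^] n"
  by (simp add: meval_power[OF assms] meval_uminus[OF assms] meval_1[OF assms])

section \<open>Terms and changes of coordinates in a model\<close>

context lambda_model
begin

text \<open>\<open>lambda_ring\<close> is inherited twice, for \<open>lam\<close> and for
  \<open>sig\<close>; separate names keep the two instances apart.\<close>

lemmas lambda_ring_lam = lambda_model.axioms(1)[OF lambda_model_axioms]
lemmas lambda_ring_sig = special_lambda_ring.axioms(1)[OF lambda_model.axioms(2)[OF lambda_model_axioms]]

lemmas lam_in = lambda_ring.lam_closed[OF lambda_ring_lam]
lemmas lam_zero = lambda_ring.lam_0[OF lambda_ring_lam]
lemmas sig_in = lambda_ring.lam_closed[OF lambda_ring_sig]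
lemmas sig_one = lambda_ring.lam_1[OF lambda_ring_sig]

lemma sig_lam_inverse:
  assumes "x \<in> carrier R"
  shows "(\<Oplus>i\<in>{..n}. sig i x \<otimes> ((\<ominus> \<one>) [^] (n - i) \<otimes> lam (n - i) x)) = (if n = 0 then \<one> else \<zero>)"
  using fun_cong[OF sig_inverse[OF assms], of n] by (simp add: ps_mult_def ps_one_def)

text \<open>Both sides are coefficients of the inverse of the \<lambda> series at -t, and that
  series can be cancelled.\<close>

lemma sig_eq_meval_lam:
  assumes x: "x \<in> carrier R"
  shows "sig n x = meval R (\<lambda>i. lam i x) (Pop_poly n)"
proof (rule power_series_cancel[where a = "\<lambda>i. (\<ominus> \<one>) [^] i \<otimes> lam i x" and b = "\<lambda>i. sig i x"
      and b' = "\<lambda>i. meval R (\<lambda>i. lam i x) (Pop_poly i)" and n = n])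
  let ?e = "meval R (\<lambda>i. lam i x)"
  have l: "lam i x \<in> carrier R" for i
    using x by (rule lam_in)
  fix n
  have "?e (if k = 0 then 1 else mvar k) = lam k x" for k
    using x by (simp add: meval_1[OF l] meval_mvar[OF l] lam_zero)
  then have "?e ((-1) ^ k * (if k = 0 then 1 else mvar k)) = (\<ominus> \<one>) [^] k \<otimes> lam k x" for k
    by (simp add: meval_mult[OF l] meval_minus_one_power[OF l])
  moreover have "conv Pop_poly (\<lambda>k. (-1) ^ k * (if k = 0 then 1 else mvar k)) n = (if n = 0 then 1 else 0)"
    using opposite_mvar_Pop_poly unfolding opposite_iff conv_def by blast
  then have "?e (conv Pop_poly (\<lambda>k. (-1) ^ k * (if k = 0 then 1 else mvar k)) n) = (if n = 0 then \<one> else \<zero>)"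
    by (simp add: meval_1[OF l] meval_0[OF l])
  ultimately show "(\<Oplus>i\<in>{..n}. sig i x \<otimes> ((\<ominus> \<one>) [^] (n - i) \<otimes> lam (n - i) x))
      = (\<Oplus>i\<in>{..n}. ?e (Pop_poly i) \<otimes> ((\<ominus> \<one>) [^] (n - i) \<otimes> lam (n - i) x))"
    by (simp only: sig_lam_inverse[OF x] meval_conv[OF l])
qed (simp_all add: x lam_in lam_zero sig_in)

text \<open>\<open>Pop_poly\<close> is its own inverse, so the previous conversion also works
  backwards.\<close>

lemma lam_eq_meval_sig:
  assumes x: "x \<in> carrier R"
  shows "lam n x = meval R (\<lambda>i. sig i x) (Pop_poly n)"
proof -
  have s: "sig i x \<in> carrier R" for i
    using x by (rule sig_in)
  have "lam n x = meval R (\<lambda>i. lam i x) (mvar n)"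
    using x by (simp add: meval_mvar lam_in)
  also have "\<dots> = meval R (\<lambda>i. lam i x) (if n = 0 then 1 else mvar n)"
    using x by (simp add: meval_mvar meval_1 lam_in lam_zero)
  also have "(if n = 0 then 1 else mvar n) = msubst Pop_poly (Pop_poly n)"
    using Pop_poly_Pop_poly[OF is_ring_hom_mconst, of n mvar]
    by (simp add: Pop_poly.simps[of 0] msubst_id[OF Pop_poly_in] flip: msubst_eq_peval)
  also have "meval R (\<lambda>i. lam i x) \<dots> = meval R (\<lambda>i. sig i x) (Pop_poly n)"
    by (simp add: meval_msubst x lam_in sig_eq_meval_lam)
  finally show ?thesis .
qed

text \<open>\<lambda> and \<psi> are first rewritten through \<sigma>, for which
  \<open>sig_formula_sound\<close> is available.\<close>

lemma term_formula_sound: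
  assumes r: "\<And>i. r i \<in> carrier R" and "term_formula \<phi> p"
  shows "interp R lam sig psi r \<phi> = meval R (\<lambda>(i, j). sig j (r i)) p"
proof -
  let ?e = "\<lambda>(i, j). sig j (r i)"
  have e: "?e v \<in> carrier R" for v
    by (simp add: sig_in r split: prod.splits)
  note ev = meval_0[OF e] meval_1[OF e] meval_add[OF e] meval_mult[OF e] meval_uminus[OF e]
    meval_mvar[OF e] meval_msubst[OF e] meval_closed[OF e]
  show ?thesis
    using assms(2)
  proof (induction rule: term_formula.induct)
    case (Var i)
    show ?case using sig_one[OF r] by (simp add: ev)
  next
    case (Lam s p f k)
    then show ?case
      using sig_formula_sound[OF r Lam.hyps(2)] by (simp add: lam_eq_meval_sig ev)
  next
    case (Sig s p f k)
    then show ?case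
      using sig_formula_sound[OF r Sig.hyps(2)] by simp
  next
    case (Psi s p f k)
    then show ?case
      using sig_formula_sound[OF r Psi.hyps(2)] by (simp add: psi_eq ev)
  qed (simp_all add: ev)
qed

end

text \<open>Change of coordinates from \<open>\<sigma>\<^sup>j(x\<^sub>i)\<close> to
  \<open>\<lambda>\<^sup>j(x\<^sub>i)\<close>; it respects the depth bound because
  \<open>Pop_poly j\<close> uses indices up to \<open>j\<close>.\<close>

definition lam_formula :: "ipoly \<Rightarrow> ipoly" where
  "lam_formula = msubst (\<lambda>(i, j). msubst (\<lambda>l. mvar (i, l)) (Pop_poly j))"

lemma lam_formula_in:
  assumes "p \<in> polys_in (vars_upto d)"
  shows "lam_formula p \<in> polys_in (vars_upto d)"
  unfolding lam_formula_def
proof (rule polys_in_msubst[OF assms], clarify)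
  fix i j assume "(i, j) \<in> vars_upto d"
  then show "msubst (\<lambda>l. mvar (i, l)) (Pop_poly j) \<in> polys_in (vars_upto d)"
    by (intro polys_in_msubst[OF Pop_poly_in] polys_in_mvar) (auto simp: vars_upto_def)
qed

lemma (in lambda_model) meval_lam_formula:
  assumes r: "\<And>i. r i \<in> carrier R"
  shows "meval R (\<lambda>(i, j). lam j (r i)) (lam_formula p) = meval R (\<lambda>(i, j). sig j (r i)) p"
proof -
  let ?e = "\<lambda>(i, j). lam j (r i)"
  have e: "?e v \<in> carrier R" for v
    by (simp add: lam_in r split: prod.splits)
  have "(\<lambda>v. meval R ?e ((\<lambda>(i, j). msubst (\<lambda>l. mvar (i, l)) (Pop_poly j)) v)) = (\<lambda>(i, j). sig j (r i))"
    by (auto simp: meval_msubst[OF e] meval_mvar[OF e] sig_eq_meval_lam r)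
  then show ?thesis
    by (simp add: lam_formula_def meval_msubst[OF e])
qed

lemma depth_outside: "is_term n \<phi> \<Longrightarrow> i \<notin> {1..n} \<Longrightarrow> depth \<phi> i = 0"
  by (induction \<phi>) auto

lemma depth_vars_eq: "is_term n \<phi> \<Longrightarrow> depth_vars n \<phi> = vars_upto (depth \<phi>)"
  using depth_outside[of n \<phi>] by (fastforce simp: depth_vars_def vars_upto_def)

lemma interp_cong:
  assumes "is_term n \<phi>" "\<And>i. i \<in> {1..n} \<Longrightarrow> r i = r' i"
  shows "interp R lam sig psi r \<phi> = interp R lam sig psi r' \<phi>"
  using assms(1) by (induction \<phi>) (simp_all add: assms(2))

lemma represents_lam_formula:
  assumes \<phi>: "is_term n \<phi>" and p: "term_formula \<phi> p" "p \<in> polys_in (vars_upto (depth \<phi>))"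
  shows "represents TYPE('a) n \<phi> (lam_formula p)"
  unfolding represents_def
proof (intro allI impI)
  fix R :: "'a ring" and lam sig psi r
  assume "lambda_model R lam sig psi" and r: "\<forall>i\<in>{1..n}. r i \<in> carrier R"
  then interpret lambda_model R lam sig psi by simp
  \<comment> \<open>The evaluation lemmas want every variable to have a value in the carrier,
    whereas \<open>r\<close> is controlled only on \<open>{1..n}\<close>.\<close>
  define r' where "r' i = (if i \<in> {1..n} then r i else \<zero>\<^bsub>R\<^esub>)" for i
  have r': "r' i \<in> carrier R" for i
    using r by (simp add: r'_def)
  have "interp R lam sig psi r \<phi> = interp R lam sig psi r' \<phi>"
    using \<phi> by (rule interp_cong) (simp add: r'_def)
  also have "\<dots> = meval R (\<lambda>(i, j). lam j (r' i)) (lam_formula p)"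
    by (simp add: term_formula_sound[OF r' p(1)] meval_lam_formula r')
  also have "\<dots> = meval R (\<lambda>(i, j). lam j (r i)) (lam_formula p)"
  proof (rule meval_cong[symmetric])
    show "lam_formula p \<in> polys_in (depth_vars n \<phi>)"
      unfolding depth_vars_eq[OF \<phi>] by (rule lam_formula_in[OF p(2)])
    show "(\<lambda>(i, j). lam j (r i)) v = (\<lambda>(i, j). lam j (r' i)) v" if "v \<in> depth_vars n \<phi>" for v
      using that by (auto simp: depth_vars_def r'_def)
    show "(\<lambda>(i, j). lam j (r' i)) v \<in> carrier R" for v
      by (simp add: lam_in r' split: prod.splits)
  qed
  finally show "interp R lam sig psi r \<phi> = meval R (\<lambda>(i, j). lam j (r i)) (lam_formula p)" .
qed

lemma simplification_in: "is_term n \<phi> \<Longrightarrow> simplification \<phi> \<in> polys_in pos_vars"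
  by (induction \<phi>) (auto simp: simplification_Lam simplification_Sig rlam_in rsig_in ApplyPsi_in
      intro: polys_in_intros simp del: simplification.simps(7,8))

text \<open>The generic point of the transported rational model makes both sides explicit: the term
  evaluates to the output of the algorithm and the polynomial to itself.\<close>

lemma represents_imp_simplification_eq:
  fixes h :: "rpoly \<Rightarrow> 'c"
  assumes h: "inj h" and \<phi>: "is_term n \<phi>"
    and Q: "Q \<in> polys_in (depth_vars n \<phi>)" "represents TYPE('c) n \<phi> Q"
  shows "simplification \<phi> = to_rat Q"
proof -
  interpret transport h "polys_in pos_vars"
    by unfold_locales (auto simp: h intro: polys_in_intros)
  let ?lam = "\<lambda>k x. h (rlam k (inv_into UNIV h x))"
  let ?sig = "\<lambda>k x. h (rsig k (inv_into UNIV h x))"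
  let ?psi = "\<lambda>k x. h (ApplyPsi (inv_into UNIV h x) k)"
  let ?r = "\<lambda>i. h (mvar (i, 1))"
  have "interp R ?lam ?sig ?psi ?r \<phi> = h (simplification \<phi>)"
    using \<phi>
    by (induction \<phi>) (simp_all add: simplification_Lam simplification_Sig R_uminus simplification_in
      del: simplification.simps(7,8))
  moreover have "interp R ?lam ?sig ?psi ?r \<phi> = meval R (\<lambda>(i, j). ?lam j (?r i)) Q"
    by (rule Q(2)[unfolded represents_def, rule_format, OF lambda_model_transported[OF h]])
      (auto intro: polys_in_mvar)
  ultimately have "h (simplification \<phi>) = meval R (\<lambda>(i, j). ?lam j (?r i)) Q"
    by simp
  also have "(\<lambda>(i, j). ?lam j (?r i)) = (\<lambda>v. h ((\<lambda>(i, j). rlam j (mvar (i, 1))) v))"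
    by auto
  also have "meval R \<dots> Q = h (msubst (\<lambda>(i, j). rlam j (mvar (i, 1))) (to_rat Q))"
    by (subst meval_R) (auto simp: rlam_in peval_of_int)
  also have "msubst (\<lambda>(i, j). rlam j (mvar (i, 1))) (to_rat Q) = to_rat Q"
    using Q(1) by (intro msubst_id[where V = "depth_vars n \<phi>"])
      (auto simp: to_rat_in_polys_in_iff depth_vars_def rlam_mvar[unfolded One_nat_def])
  finally show ?thesis
    using h by (simp add: inj_eq)
qed

section \<open>Countability and conclusion\<close>

text \<open>A finitely supported map is determined by its graph over the support, which is a finite
  subset of a countable set.\<close>

lemma countable_poly_mapping:
  assumes "countable (UNIV :: 'k set)" "countable (UNIV :: 'v::zero set)"
  shows "countable (UNIV :: ('k \<Rightarrow>\<^sub>0 'v) set)"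
proof -
  let ?graph = "\<lambda>p :: 'k \<Rightarrow>\<^sub>0 'v. (\<lambda>k. (k, Poly_Mapping.lookup p k)) ` Poly_Mapping.keys p"
  have "inj ?graph"
  proof (rule injI, rule poly_mapping_eqI)
    fix p q :: "'k \<Rightarrow>\<^sub>0 'v" and k assume "?graph p = ?graph q"
    then have graph: "(k, v) \<in> ?graph p \<longleftrightarrow> (k, v) \<in> ?graph q" for v
      by (simp only:)
    show "Poly_Mapping.lookup p k = Poly_Mapping.lookup q k"
      using graph[of "Poly_Mapping.lookup p k"] graph[of "Poly_Mapping.lookup q k"]
      by (auto simp: in_keys_iff image_iff)
  qed
  moreover have "countable {A :: ('k \<times> 'v) set. finite A \<and> A \<subseteq> UNIV \<times> UNIV}"
    using assms by (intro countable_Collect_finite_subset countable_SIGMA) auto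
  then have "countable (range ?graph)"
    by (rule countable_subset[rotated]) auto
  ultimately show ?thesis
    by (rule countable_image_inj_on[rotated])
qed

theorem theorem1p1:
  fixes n :: nat and \<phi> :: lterm
  assumes "is_term n \<phi>"
  shows "\<exists>P \<in> polys_in (depth_vars n \<phi>).
           represents TYPE('a) n \<phi> P \<and>
           (\<forall>Q \<in> polys_in (depth_vars n \<phi>). represents TYPE(nat) n \<phi> Q \<longrightarrow> Q = P) \<and>
           simplification \<phi> = to_rat P"
proof -
  obtain p where p: "term_formula \<phi> p" "p \<in> polys_in (vars_upto (depth \<phi>))"
    using term_formula_exists[OF assms] by blast
  let ?P = "lam_formula p"
  have P_in: "?P \<in> polys_in (depth_vars n \<phi>)"
    unfolding depth_vars_eq[OF assms] by (rule lam_formula_in[OF p(2)])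
  note P_rep = represents_lam_formula[OF assms p]
  \<comment> \<open>The universe in \<open>P_rep\<close> is arbitrary; here it is
    \<open>rpoly\<close> itself, with the identity as injection.\<close>
  have P_eq: "simplification \<phi> = to_rat ?P"
    by (rule represents_imp_simplification_eq[OF inj_on_id assms P_in P_rep])
  have "countable (UNIV :: rpoly set)"
    by (intro countable_poly_mapping countableI_type)
  then obtain h :: "rpoly \<Rightarrow> nat" where h: "inj h"
    by (rule countableE)
  \<comment> \<open>Under the injective \<open>to_rat\<close>, both polynomials become the output of
    the algorithm.\<close>
  have "Q = ?P" if "Q \<in> polys_in (depth_vars n \<phi>)" "represents TYPE(nat) n \<phi> Q" for Q
    using represents_imp_simplification_eq[OF h assms that] P_eq by (simp add: to_rat_inject)
  then show ?thesis
    using P_in P_rep P_eq by blast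
qed

end
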